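(* Let $G$ and $H$ be groups equipped with conjugation-invariant norms, and equip $G\times H$ with the associated $L^1$ norm $\|(g,h)\|=\|g\|_G+\|h\|_H$. Then for any scaling set $T$ there is a natural isometry of groups (i.e. an isometric group isomorphism) $$\hat{\mathcal{C}}(G\times H,T)\xrightarrow{\ \cong\ }\hat{\mathcal{C}}(G,T)\times\hat{\mathcal{C}}(H,T),\qquad [g\times h]\mapsto([g],[h]),$$ where the codomain is equipped with the associated $L^1$ norm. Here $g\times h\colon T\to G\times H$ is the function $t\mapsto(g(t),h(t))$.
   Context: Norms. A norm on a group $G$ is a function $\|\cdot\|\colon G\to[0,\infty)$ with $\|g\|=0\iff g=1$, $\|g^{-1}\|=\|g\|$ and $\|gh\|\le\|g\|+\|h\|$; for a pseudonorm one only requires $\|1\|=0$ instead of the first condition. It is conjugation-invariant if $\|hgh^{-1}\|=\|g\|$ for all $g,h$. It induces the bi-invariant (pseudo)metric $d(g,h)=\|g^{-1}h\|$; all metric notions refer to it. The groups $F_{\mathbb{R}}(G)$ and $F(G)$. Let $G$ be a group with a conjugation-invariant norm. $F_{\mathbb{R}}(G)$ is the free product of copies of the additive group $\mathbb{R}$ indexed by the elements $g$ of the set $G$; the element $r$ of the copy indexed by $g$ is written $\overline{g}(r)$. It carries the conjugation-invariant pseudonorm $$\|x\|=\inf\Big\{\sum_{i=1}^n |r_i|\,\|g_i\| : x=\prod_{i=1}^n h_i\,\overline{g_i}(r_i)^{\pm1}h_i^{-1},\ h_i\in F_{\mathbb{R}}(G)\Big\}.$$ $F(G)\le F_{\mathbb{R}}(G)$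 is the subgroup generated by the elements $\overline{g}:=\overline{g}(1)$; it is free on $\{\overline{g}: g\in G\}$. For $t\in\mathbb{R}$, $\psi_t\colon F_{\mathbb{R}}(G)\to F_{\mathbb{R}}(G)$ is the homomorphism with $\psi_t(\overline{g}(r))=\overline{g}(tr)$. $\pi\colon F(G)\to G$ is the homomorphism with $\pi(\overline{g})=g$. Directional asymptotic cone. A scaling set is an unbounded subset $T\subseteq(0,\infty)$; limits over $t\in T$ are taken as $t\to\infty$. A function $f$ from $T$ to a pseudometric space is Cauchy if for every $\epsilon>0$, $d(f(t),f(t'))<\epsilon$ for all sufficiently large $t,t'\in T$. $\mathcal{D}(G,T)$ is the group (pointwise product) of all functions $w\colon T\to F(G)$ such that $t\mapsto\psi_{1/t}(w(t))\in F_{\mathbb{R}}(G)$ is Cauchy, with pseudonorm $\|w\|=\lim_{t\in T}\|\psi_{1/t}(w(t))\|$. $\mathcal{C}(G,T)=\{\pi\circ w: w\in\mathcal{D}(G,T)\}$, a group of functions $T\to G$, with pseudonorm $\|g\|=\inf\{\|w\|: w\in\mathcal{D}(G,T),\ \pi\circ w=g\}$. The directional asymptotic cone $\hat{\mathcal{C}}(G,T)$ is the quotient of $\mathcal{C}(G,T)$ by the normal subgroup of elements of pseudonorm $0$, with the induced conjugation-invariant norm; $[g]$ denotes the class of $g$. *)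

theory Defs
  imports Complex_Main "HOL-Algebra.Product_Groups"
begin

section \<open>Groups with conjugation-invariant norms\<close>

locale conj_inv_normed_group = group G for G (structure) +
  fixes nrm :: "'a \<Rightarrow> real"
  assumes nrm_nonneg: "x \<in> carrier G \<Longrightarrow> 0 \<le> nrm x"
    and nrm_eq_0_iff: "x \<in> carrier G \<Longrightarrow> nrm x = 0 \<longleftrightarrow> x = \<one>"
    and nrm_inv: "x \<in> carrier G \<Longrightarrow> nrm (inv x) = nrm x"
    and nrm_mult: "x \<in> carrier G \<Longrightarrow> y \<in> carrier G \<Longrightarrow> nrm (x \<otimes> y) \<le> nrm x + nrm y"
    and nrm_conj: "x \<in> carrier G \<Longrightarrow> y \<in> carrier G \<Longrightarrow> nrm (y \<otimes> x \<otimes> inv y) = nrm x"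

definition group_dist :: "('a, 'm) monoid_scheme \<Rightarrow> ('a \<Rightarrow> real) \<Rightarrow> 'a \<Rightarrow> 'a \<Rightarrow> real" where
  "group_dist G n x y = n (inv\<^bsub>G\<^esub> x \<otimes>\<^bsub>G\<^esub> y)"

definition l1_norm :: "('a \<Rightarrow> real) \<Rightarrow> ('b \<Rightarrow> real) \<Rightarrow> 'a \<times> 'b \<Rightarrow> real" where
  "l1_norm n m = (\<lambda>(x, y). n x + m y)"

definition isometric_iso ::
  "('a, 'm) monoid_scheme \<Rightarrow> ('a \<Rightarrow> real) \<Rightarrow> ('b, 'k) monoid_scheme \<Rightarrow> ('b \<Rightarrow> real) \<Rightarrow> ('a \<Rightarrow> 'b) set"
  where
  "isometric_iso G n H m =
     {f \<in> iso G H. \<forall>x\<in>carrier G. \<forall>y\<in>carrier G.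
        group_dist H m (f x) (f y) = group_dist G n x y}"


section \<open>Free products of copies of the reals\<close>

text \<open>
  Elements of the free product are represented by reduced words: a letter \<open>(g, r)\<close> is the nonzero
  real \<open>r\<close> in the copy indexed by \<open>g\<close>, and adjacent letters belong to different copies.
  The set \<open>S\<close> restricts the exponents.
\<close>

definition reduced_words :: "'a set \<Rightarrow> real set \<Rightarrow> ('a \<times> real) list set" where
  "reduced_words I S = {w. set w \<subseteq> I \<times> (S - {0}) \<and> distinct_adj (map fst w)}"

fun letter_cons :: "'a \<times> real \<Rightarrow> ('a \<times> real) list \<Rightarrow> ('a \<times> real) list" where
  "letter_cons (g, r) w =
     (if r = 0 then w
      else case w of
        [] \<Rightarrow> [(g, r)]
      | (h, s) # v \<Rightarrow>
          if g = h then (if r + s = 0 then v else (g, r + s) # v) else (g, r) # w)"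

definition real_free_product :: "'a set \<Rightarrow> ('a \<times> real) list monoid" where
  "real_free_product I =
     \<lparr>carrier = reduced_words I UNIV, mult = (\<lambda>u v. foldr letter_cons u v), one = []\<rparr>"

definition letter :: "'a \<Rightarrow> real \<Rightarrow> ('a \<times> real) list" where
  "letter g r = letter_cons (g, r) []"

definition list_prod :: "('b, 'k) monoid_scheme \<Rightarrow> 'b list \<Rightarrow> 'b" where
  "list_prod K xs = foldr (\<otimes>\<^bsub>K\<^esub>) xs \<one>\<^bsub>K\<^esub>"

text \<open>
  The map induced on words by \<open>f g\<close> on the copy indexed by \<open>g\<close>. It is a homomorphism if every
  \<open>f g\<close> is one: see \<open>word_eval_mult\<close> and \<open>word_eval_letter\<close> below.
\<close>

definition word_eval :: "('b, 'k) monoid_scheme \<Rightarrow> ('a \<Rightarrow> real \<Rightarrow> 'b) \<Rightarrow> ('a \<times> real) list \<Rightarrow> 'b" where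
  "word_eval K f w = list_prod K (map (\<lambda>(g, r). f g r) w)"

lemma reduced_words_Nil: "[] \<in> reduced_words I S"
  by (simp add: reduced_words_def)

lemma reduced_words_Cons:
  "(g, r) # w \<in> reduced_words I S \<longleftrightarrow>
     g \<in> I \<and> r \<in> S \<and> r \<noteq> 0 \<and> w \<in> reduced_words I S \<and> (w = [] \<or> g \<noteq> fst (hd w))"
  by (cases w) (auto simp: reduced_words_def)

lemma letter_cons_closed:
  assumes "g \<in> I" "r \<in> S" "w \<in> reduced_words I S" "\<And>a b. a \<in> S \<Longrightarrow> b \<in> S \<Longrightarrow> a + b \<in> S"
  shows "letter_cons (g, r) w \<in> reduced_words I S"
  using assms by (cases w) (auto simp: reduced_words_Cons reduced_words_Nil)

lemma letter_cons_add:
  assumes "w \<in> reduced_words I S"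
  shows "letter_cons (g, r) (letter_cons (g, s) w) = letter_cons (g, r + s) w"
proof (cases w)
  case Nil
  then show ?thesis by auto
next
  case (Cons a v)
  obtain h t where a: "a = (h, t)" by (cases a)
  show ?thesis
    using assms unfolding Cons a
    by (cases v) (auto simp: reduced_words_Cons add.assoc)
qed

lemma foldr_letter_cons_closed:
  assumes "set u \<subseteq> I \<times> S" "w \<in> reduced_words I S" "\<And>a b. a \<in> S \<Longrightarrow> b \<in> S \<Longrightarrow> a + b \<in> S"
  shows "foldr letter_cons u w \<in> reduced_words I S"
  using assms(1)
proof (induction u)
  case (Cons a u)
  obtain g r where a: "a = (g, r)" by (cases a)
  have "foldr letter_cons u w \<in> reduced_words I S" "g \<in> I" "r \<in> S"
    using Cons a by auto
  then show ?case
    using letter_cons_closed[of g I r S "foldr letter_cons u w"] assms(3) a by simp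
qed (use assms in simp)

lemma foldr_letter_cons_letter_cons:
  assumes "u \<in> reduced_words I UNIV" "w \<in> reduced_words I UNIV"
  shows "foldr letter_cons (letter_cons (g, r) u) w = letter_cons (g, r) (foldr letter_cons u w)"
proof (cases u)
  case (Cons a v)
  obtain h s where a: "a = (h, s)" by (cases a)
  define z where "z = foldr letter_cons v w"
  have "set v \<subseteq> I \<times> UNIV"
    using assms(1) Cons by (auto simp: reduced_words_def)
  then have z: "z \<in> reduced_words I UNIV"
    unfolding z_def using assms(2) by (intro foldr_letter_cons_closed) auto
  consider "r = 0" | "r \<noteq> 0" "g \<noteq> h" | "r \<noteq> 0" "g = h" "r + s = 0" | "r \<noteq> 0" "g = h" "r + s \<noteq> 0"
    by blast
  then show ?thesis
  proof cases
    case 3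
    have "letter_cons (g, r) (letter_cons (h, s) z) = z"
      using letter_cons_add[OF z, of g r s] 3 by simp
    then show ?thesis
      using 3 Cons a by (simp add: z_def del: letter_cons.simps) (simp add: z_def)
  next
    case 4
    have "letter_cons (g, r) (letter_cons (h, s) z) = letter_cons (g, r + s) z"
      using letter_cons_add[OF z, of g r s] 4 by simp
    moreover have "letter_cons (g, r) u = (g, r + s) # v"
      using 4 Cons a by simp
    ultimately show ?thesis
      using Cons a by (simp add: z_def del: letter_cons.simps)
  next
    case 2
    then have "letter_cons (g, r) u = (g, r) # u"
      using Cons a by simp
    then show ?thesis by (simp del: letter_cons.simps)
  qed simp
qed simp

lemma group_real_free_product: "group (real_free_product I)"
proof -
  let ?R = "reduced_words I UNIV"
  have [simp]: "carrier (real_free_product I) = ?R" "\<one>\<^bsub>real_free_product I\<^esub> = []"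
    "\<And>u v. u \<otimes>\<^bsub>real_free_product I\<^esub> v = foldr letter_cons u v"
    by (auto simp: real_free_product_def)
  have closed: "foldr letter_cons u v \<in> ?R" if "u \<in> ?R" "v \<in> ?R" for u v
    using that by (intro foldr_letter_cons_closed) (auto simp: reduced_words_def)
  have assoc: "foldr letter_cons (foldr letter_cons u v) w
      = foldr letter_cons u (foldr letter_cons v w)"
    if "u \<in> ?R" "v \<in> ?R" "w \<in> ?R" for u v w
    using that(1)
  proof (induction u)
    case (Cons a u)
    obtain g r where a: "a = (g, r)" by (cases a)
    have u: "u \<in> ?R" using Cons.prems a by (simp add: reduced_words_Cons)
    show ?case
      using foldr_letter_cons_letter_cons[OF closed[OF u that(2)] that(3)] Cons.IH[OF u] a
      by (simp del: letter_cons.simps)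
  qed simp
  have inv: "\<exists>v\<in>carrier (real_free_product I). v \<otimes>\<^bsub>real_free_product I\<^esub> u = \<one>\<^bsub>real_free_product I\<^esub>"
    if "u \<in> carrier (real_free_product I)" for u
  proof -
    from that have "u \<in> ?R" by simp
    then have "\<exists>v\<in>?R. foldr letter_cons v u = []"
    proof (induction u)
      case Nil
      show ?case by (intro bexI[of _ "[]"]) (auto simp: reduced_words_Nil)
    next
      case (Cons a u)
      obtain g r where a: "a = (g, r)" by (cases a)
      have g: "g \<in> I" "r \<noteq> 0" and u: "u \<in> ?R"
        using Cons.prems a by (auto simp: reduced_words_Cons)
      obtain v where v: "v \<in> ?R" "foldr letter_cons v u = []"
        using Cons.IH[OF u] by blast
      have l: "[(g, - r)] \<in> ?R"
        using g by (simp add: reduced_words_Cons reduced_words_Nil)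
      have "foldr letter_cons (foldr letter_cons v [(g, - r)]) (a # u)
          = foldr letter_cons v (foldr letter_cons [(g, - r)] (a # u))"
        using assoc[OF v(1) l Cons.prems] .
      also have "\<dots> = []" using v a g by simp
      finally show ?case using closed[OF v(1) l] by blast
    qed
    then show ?thesis by simp
  qed
  show ?thesis
    by (rule groupI) (use closed assoc inv in \<open>simp_all add: reduced_words_Nil\<close>)
qed

lemma letter_in_real_free_product: "g \<in> I \<Longrightarrow> letter g r \<in> carrier (real_free_product I)"
  by (simp add: letter_def real_free_product_def reduced_words_Cons reduced_words_Nil)

lemma letter_add: "letter g r \<otimes>\<^bsub>real_free_product I\<^esub> letter g s = letter g (r + s)"
  by (simp add: letter_def real_free_product_def)

lemma word_eval_Cons: "word_eval K f ((g, r) # w) = f g r \<otimes>\<^bsub>K\<^esub> word_eval K f w"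
  by (simp add: word_eval_def list_prod_def)

lemma word_eval_Nil: "word_eval K f [] = \<one>\<^bsub>K\<^esub>"
  by (simp add: word_eval_def list_prod_def)

context
  fixes K :: "('b, 'k) monoid_scheme" and I :: "'a set" and S :: "real set" and f :: "'a \<Rightarrow> real \<Rightarrow> 'b"
  assumes K: "group K"
    and S_add: "\<And>r s. r \<in> S \<Longrightarrow> s \<in> S \<Longrightarrow> r + s \<in> S"
    and S_0: "0 \<in> S"
    and f_closed: "\<And>g r. g \<in> I \<Longrightarrow> r \<in> S \<Longrightarrow> f g r \<in> carrier K"
    and f_add: "\<And>g r s. g \<in> I \<Longrightarrow> r \<in> S \<Longrightarrow> s \<in> S \<Longrightarrow> f g (r + s) = f g r \<otimes>\<^bsub>K\<^esub> f g s"
begin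

interpretation K: group K by (rule K)

lemma word_eval_f_0: "g \<in> I \<Longrightarrow> f g 0 = \<one>\<^bsub>K\<^esub>"
  using f_add[of g 0 0] f_closed[of g 0] S_0 by (metis K.l_cancel_one' add.right_neutral)

lemma word_eval_closed: "w \<in> reduced_words I S \<Longrightarrow> word_eval K f w \<in> carrier K"
proof (induction w)
  case (Cons a w)
  then show ?case
    by (cases a) (auto simp: word_eval_Cons reduced_words_Cons f_closed)
qed (simp add: word_eval_Nil)

lemma word_eval_letter_cons:
  assumes "g \<in> I" "r \<in> S" "w \<in> reduced_words I S"
  shows "word_eval K f (letter_cons (g, r) w) = f g r \<otimes>\<^bsub>K\<^esub> word_eval K f w"
proof (cases "r = 0")
  case True
  then show ?thesis
    using word_eval_f_0[OF assms(1)] word_eval_closed[OF assms(3)] by simp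
next
  case r: False
  show ?thesis
  proof (cases w)
    case Nil
    then show ?thesis using r by (simp add: word_eval_Cons)
  next
    case (Cons a v)
    obtain h s where a: "a = (h, s)" by (cases a)
    have hs: "h \<in> I" "s \<in> S" and v: "word_eval K f v \<in> carrier K"
      using assms(3) Cons a word_eval_closed[of v] by (auto simp: reduced_words_Cons)
    have "f h r \<otimes>\<^bsub>K\<^esub> (f h s \<otimes>\<^bsub>K\<^esub> word_eval K f v) = f h (r + s) \<otimes>\<^bsub>K\<^esub> word_eval K f v"
      using hs v assms(2) by (simp add: f_add f_closed K.m_assoc)
    then show ?thesis
      using Cons a r v word_eval_f_0[OF hs(1)] by (auto simp: word_eval_Cons)
  qed
qed

lemma word_eval_letter: "g \<in> I \<Longrightarrow> r \<in> S \<Longrightarrow> word_eval K f (letter g r) = f g r"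
  unfolding letter_def
  by (subst word_eval_letter_cons) (auto simp: word_eval_Nil reduced_words_Nil f_closed)

lemma word_eval_mult:
  assumes "u \<in> reduced_words I S" "v \<in> reduced_words I S"
  shows "word_eval K f (u \<otimes>\<^bsub>real_free_product I\<^esub> v) = word_eval K f u \<otimes>\<^bsub>K\<^esub> word_eval K f v"
proof -
  have "word_eval K f (foldr letter_cons u v) = word_eval K f u \<otimes>\<^bsub>K\<^esub> word_eval K f v"
    using assms(1)
  proof (induction u)
    case Nil
    then show ?case using word_eval_closed[OF assms(2)] by (simp add: word_eval_Nil)
  next
    case (Cons a u)
    obtain g r where a: "a = (g, r)" by (cases a)
    have g: "g \<in> I" "r \<in> S" and u: "u \<in> reduced_words I S"
      using Cons.prems a by (auto simp: reduced_words_Cons)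
    have "foldr letter_cons u v \<in> reduced_words I S"
      using u assms(2) S_add by (intro foldr_letter_cons_closed) (auto simp: reduced_words_def)
    then have "word_eval K f (foldr letter_cons (a # u) v)
        = f g r \<otimes>\<^bsub>K\<^esub> word_eval K f (foldr letter_cons u v)"
      using word_eval_letter_cons[OF g] a by (simp del: letter_cons.simps)
    then show ?case
      using Cons.IH[OF u] a g word_eval_closed[OF u] word_eval_closed[OF assms(2)]
      by (simp add: word_eval_Cons K.m_assoc f_closed)
  qed
  then show ?thesis by (simp add: real_free_product_def)
qed

end


section \<open>The groups \<open>F\<^sub>\<real>(G)\<close> and \<open>F(G)\<close>\<close>

abbreviation FR :: "('a, 'm) monoid_scheme \<Rightarrow> ('a \<times> real) list monoid" where
  "FR G \<equiv> real_free_product (carrier G)"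

definition FR_norm :: "('a, 'm) monoid_scheme \<Rightarrow> ('a \<Rightarrow> real) \<Rightarrow> ('a \<times> real) list \<Rightarrow> real" where
  "FR_norm G n x =
     Inf {(\<Sum>(h, g, r, e) \<leftarrow> L. \<bar>r\<bar> * n g) | L :: (('a \<times> real) list \<times> 'a \<times> real \<times> int) list.
            set L \<subseteq> carrier (FR G) \<times> carrier G \<times> UNIV \<times> {1, -1} \<and>
            x = list_prod (FR G)
                  (map (\<lambda>(h, g, r, e).
                     h \<otimes>\<^bsub>FR G\<^esub> (letter g r [^]\<^bsub>FR G\<^esub> e) \<otimes>\<^bsub>FR G\<^esub> inv\<^bsub>FR G\<^esub> h) L)}"

definition FZ :: "('a, 'm) monoid_scheme \<Rightarrow> ('a \<times> real) list monoid" where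
  "FZ G = subgroup_generated (FR G) ((\<lambda>g. letter g 1) ` carrier G)"

definition scale_hom :: "('a, 'm) monoid_scheme \<Rightarrow> real \<Rightarrow> ('a \<times> real) list \<Rightarrow> ('a \<times> real) list" where
  "scale_hom G t = word_eval (FR G) (\<lambda>g r. letter g (t * r))"

text \<open>The exponents occurring in elements of \<open>FZ G\<close> are integers, so the floor is harmless.\<close>

definition FZ_proj :: "('a, 'm) monoid_scheme \<Rightarrow> ('a \<times> real) list \<Rightarrow> 'a" where
  "FZ_proj G = word_eval G (\<lambda>g r. g [^]\<^bsub>G\<^esub> \<lfloor>r\<rfloor>)"

lemma scale_hom_hom: "scale_hom G t \<in> hom (FR G) (FR G)"
proof -
  interpret FR: group "FR G" by (rule group_real_free_product)
  have carr: "carrier (FR G) = reduced_words (carrier G) UNIV"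
    by (simp add: real_free_product_def)
  show ?thesis
    unfolding scale_hom_def
  proof (rule homI)
    fix x y assume "x \<in> carrier (FR G)" "y \<in> carrier (FR G)"
    then show "word_eval (FR G) (\<lambda>g r. letter g (t * r)) (x \<otimes>\<^bsub>FR G\<^esub> y) =
        word_eval (FR G) (\<lambda>g r. letter g (t * r)) x \<otimes>\<^bsub>FR G\<^esub> word_eval (FR G) (\<lambda>g r. letter g (t * r)) y"
      unfolding carr
      by (intro word_eval_mult[where S = UNIV])
        (auto simp: letter_in_real_free_product letter_add distrib_left FR.is_group)
  next
    fix x assume "x \<in> carrier (FR G)"
    then show "word_eval (FR G) (\<lambda>g r. letter g (t * r)) x \<in> carrier (FR G)"
      by (intro word_eval_closed[where S = UNIV and I = "carrier G"])
        (auto simp: carr[symmetric] letter_in_real_free_product letter_add distrib_left FR.is_group)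
  qed
qed

lemma scale_hom_letter:
  assumes "g \<in> carrier G"
  shows "scale_hom G t (letter g r) = letter g (t * r)"
  unfolding scale_hom_def using assms group_real_free_product
  by (intro word_eval_letter[where S = UNIV and I = "carrier G"])
    (auto simp: letter_in_real_free_product letter_add distrib_left)

lemma FZ_words:
  assumes "x \<in> carrier (FZ G)"
  shows "x \<in> reduced_words (carrier G) \<int>"
proof -
  interpret FR: group "FR G" by (rule group_real_free_product)
  have letter_int: "letter g r \<in> reduced_words (carrier G) \<int>" if "g \<in> carrier G" "r \<in> \<int>" for g r
    using that by (simp add: letter_def reduced_words_Cons reduced_words_Nil)
  have "x \<in> generate (FR G) (carrier (FR G) \<inter> (\<lambda>g. letter g 1) ` carrier G)"
    using assms by (simp add: FZ_def carrier_subgroup_generated)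
  then show ?thesis
  proof induction
    case one
    then show ?case by (simp add: real_free_product_def reduced_words_Nil)
  next
    case (incl h)
    then show ?case using letter_int by auto
  next
    case (inv h)
    then obtain g where g: "g \<in> carrier G" "h = letter g 1" by auto
    have "letter g (- 1) \<otimes>\<^bsub>FR G\<^esub> letter g 1 = \<one>\<^bsub>FR G\<^esub>"
      unfolding letter_add by (simp add: letter_def real_free_product_def)
    then have "inv\<^bsub>FR G\<^esub> h = letter g (- 1)"
      using g by (intro FR.inv_equality) (auto simp: letter_in_real_free_product)
    then show ?case using letter_int g by simp
  next
    case (eng u v)
    then show ?case
      unfolding real_free_product_def
      by (simp, intro foldr_letter_cons_closed) (auto simp: reduced_words_def)
  qed
qed

lemma (in group) FZ_proj_hom: "FZ_proj G \<in> hom (FZ G) G"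
proof (rule homI)
  fix x y assume xy: "x \<in> carrier (FZ G)" "y \<in> carrier (FZ G)"
  have "FZ_proj G (x \<otimes>\<^bsub>FR G\<^esub> y) = FZ_proj G x \<otimes> FZ_proj G y"
    unfolding FZ_proj_def using xy[THEN FZ_words]
    by (intro word_eval_mult[where S = \<int>]) (auto simp: is_group int_pow_mult elim!: Ints_cases)
  then show "FZ_proj G (x \<otimes>\<^bsub>FZ G\<^esub> y) = FZ_proj G x \<otimes> FZ_proj G y"
    by (simp add: FZ_def)
next
  fix x assume "x \<in> carrier (FZ G)"
  then show "FZ_proj G x \<in> carrier G"
    unfolding FZ_proj_def
    by (intro word_eval_closed[where S = \<int> and I = "carrier G"])
      (auto simp: is_group int_pow_mult FZ_words elim!: Ints_cases)
qed

lemma (in group) FZ_proj_letter: "g \<in> carrier G \<Longrightarrow> FZ_proj G (letter g 1) = g"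
  by (simp add: FZ_proj_def letter_def word_eval_Cons word_eval_Nil int_pow_1)


section \<open>The directional asymptotic cone\<close>

definition scaling_set :: "real set \<Rightarrow> bool" where
  "scaling_set T \<longleftrightarrow> T \<subseteq> {0<..} \<and> \<not> bdd_above T"

definition pseudo_cauchy :: "real set \<Rightarrow> ('x \<Rightarrow> 'x \<Rightarrow> real) \<Rightarrow> (real \<Rightarrow> 'x) \<Rightarrow> bool" where
  "pseudo_cauchy T d f \<longleftrightarrow>
     (\<forall>\<epsilon>>0. \<exists>M. \<forall>t\<in>T. \<forall>t'\<in>T. t \<ge> M \<and> t' \<ge> M \<longrightarrow> d (f t) (f t') < \<epsilon>)"

text \<open>
  Functions on \<open>T\<close> are represented by extensional functions on the reals, with the pointwise
  product of \<open>product_group\<close>.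
\<close>

definition dir_words :: "('a, 'm) monoid_scheme \<Rightarrow> ('a \<Rightarrow> real) \<Rightarrow> real set \<Rightarrow> (real \<Rightarrow> ('a \<times> real) list) monoid"
  where
  "dir_words G n T = (product_group T (\<lambda>_. FZ G))
     \<lparr>carrier := {w \<in> T \<rightarrow>\<^sub>E carrier (FZ G).
        pseudo_cauchy T (group_dist (FR G) (FR_norm G n)) (\<lambda>t. scale_hom G (1 / t) (w t))}\<rparr>"

definition dir_words_norm ::
  "('a, 'm) monoid_scheme \<Rightarrow> ('a \<Rightarrow> real) \<Rightarrow> real set \<Rightarrow> (real \<Rightarrow> ('a \<times> real) list) \<Rightarrow> real" where
  "dir_words_norm G n T w =
     Lim (inf at_top (principal T)) (\<lambda>t. FR_norm G n (scale_hom G (1 / t) (w t)))"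

definition dir_group :: "('a, 'm) monoid_scheme \<Rightarrow> ('a \<Rightarrow> real) \<Rightarrow> real set \<Rightarrow> (real \<Rightarrow> 'a) monoid" where
  "dir_group G n T = (product_group T (\<lambda>_. G))
     \<lparr>carrier := (\<lambda>w. compose T (FZ_proj G) w) ` carrier (dir_words G n T)\<rparr>"

definition dir_norm ::
  "('a, 'm) monoid_scheme \<Rightarrow> ('a \<Rightarrow> real) \<Rightarrow> real set \<Rightarrow> (real \<Rightarrow> 'a) \<Rightarrow> real" where
  "dir_norm G n T g =
     Inf {dir_words_norm G n T w | w.
            w \<in> carrier (dir_words G n T) \<and> compose T (FZ_proj G) w = g}"

definition null_functions ::
  "('a, 'm) monoid_scheme \<Rightarrow> ('a \<Rightarrow> real) \<Rightarrow> real set \<Rightarrow> (real \<Rightarrow> 'a) set" where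
  "null_functions G n T = {g \<in> carrier (dir_group G n T). dir_norm G n T g = 0}"

definition dir_cone ::
  "('a, 'm) monoid_scheme \<Rightarrow> ('a \<Rightarrow> real) \<Rightarrow> real set \<Rightarrow> (real \<Rightarrow> 'a) set monoid" where
  "dir_cone G n T = dir_group G n T Mod null_functions G n T"

definition dir_class ::
  "('a, 'm) monoid_scheme \<Rightarrow> ('a \<Rightarrow> real) \<Rightarrow> real set \<Rightarrow> (real \<Rightarrow> 'a) \<Rightarrow> (real \<Rightarrow> 'a) set" where
  "dir_class G n T g = null_functions G n T #>\<^bsub>dir_group G n T\<^esub> g"

text \<open>The pseudonorm is constant on each coset; the induced norm is its value there.\<close>

definition dir_cone_norm ::
  "('a, 'm) monoid_scheme \<Rightarrow> ('a \<Rightarrow> real) \<Rightarrow> real set \<Rightarrow> (real \<Rightarrow> 'a) set \<Rightarrow> real" where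
  "dir_cone_norm G n T X = the_elem (dir_norm G n T ` X)"

definition pair_fun :: "real set \<Rightarrow> (real \<Rightarrow> 'a) \<Rightarrow> (real \<Rightarrow> 'b) \<Rightarrow> real \<Rightarrow> 'a \<times> 'b" where
  "pair_fun T g h = (\<lambda>t\<in>T. (g t, h t))"

end

theory Submission
  imports Defs
begin

text \<open>
  Everything follows from the functoriality of the construction. A homomorphism \<open>f\<close> from \<open>G\<close> to \<open>H\<close>
  that does not increase the norm induces \<open>FR_map H f\<close>, which sends \<open>letter g r\<close> to \<open>letter (f g) r\<close>.
  This map does not increase \<open>FR_norm\<close>, commutes with the scalings, and lies over \<open>f\<close> under the
  projections from the integral free groups. Hence composition with \<open>f\<close> maps directional functions
  into \<open>G\<close> (the elements of \<open>dir_group\<close>) to directional functions into \<open>H\<close> and does not increase their pseudonorm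
  (\<open>dir_group_map\<close>).

  Applied to the two projections, this shows that the components of a directional function into
  \<open>G \<times>\<times> H\<close> are directional. Conversely, the pair of \<open>g\<close> and \<open>h\<close> is the pointwise product of the images
  of \<open>g\<close> and \<open>h\<close> under the inclusions of the factors; as directional functions form a
  pseudonormed group, the pair is directional, of pseudonorm at most that of \<open>g\<close> plus that of \<open>h\<close>
  (\<open>pair_fun_closed_and_norm_le\<close>).

  The reverse inequality holds already in the free products: a product of conjugates
  of letters in the copies indexed by pairs \<open>(a, b)\<close> projects to such products over \<open>G\<close> and over \<open>H\<close>,
  and the weight \<open>\<bar>r\<bar> * (nG a + nH b)\<close> of a letter is the sum of the weights of its two
  images (\<open>FR_norm_FR_map_add_le\<close>). The inequality survives the limit over \<open>T\<close> and the infimum over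
  lifts (\<open>dir_norm_fst_add_snd_le\<close>).

  So the map that sends \<open>x\<close> to the pair of classes of its components is a surjective
  homomorphism that preserves pseudonorms. Its target is a normed group, so its kernel
  consists of the elements of pseudonorm \<open>0\<close>, and the first isomorphism theorem gives the
  isometry (\<open>isometric_iso_quotient\<close>).
\<close>

section \<open>Pseudonormed groups\<close>

lemma pseudo_cauchyE:
  assumes "pseudo_cauchy T d f" "\<epsilon> > 0"
  obtains M where "\<And>t t'. t \<in> T \<Longrightarrow> t' \<in> T \<Longrightarrow> t \<ge> M \<Longrightarrow> t' \<ge> M \<Longrightarrow> d (f t) (f t') < \<epsilon>"
proof -
  from assms obtain M where
    "\<forall>t\<in>T. \<forall>t'\<in>T. t \<ge> M \<and> t' \<ge> M \<longrightarrow> d (f t) (f t') < \<epsilon>"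
    unfolding pseudo_cauchy_def by blast
  then show ?thesis by (intro that) blast
qed

lemma pseudo_cauchy_mono:
  assumes u: "pseudo_cauchy T d u"
    and le: "\<And>t t'. t \<in> T \<Longrightarrow> t' \<in> T \<Longrightarrow> e (v t) (v t') \<le> d (u t) (u t')"
  shows "pseudo_cauchy T e v"
  unfolding pseudo_cauchy_def
proof (intro allI impI)
  fix \<epsilon> :: real assume "\<epsilon> > 0"
  obtain M where M: "\<And>t t'. t \<in> T \<Longrightarrow> t' \<in> T \<Longrightarrow> t \<ge> M \<Longrightarrow> t' \<ge> M \<Longrightarrow> d (u t) (u t') < \<epsilon>"
    by (rule pseudo_cauchyE[OF u \<open>\<epsilon> > 0\<close>]) blast
  then show "\<exists>M. \<forall>t\<in>T. \<forall>t'\<in>T. t \<ge> M \<and> t' \<ge> M \<longrightarrow> e (v t) (v t') < \<epsilon>"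
    using le order_le_less_trans by blast
qed

text \<open>
  Inequalities suffice for inverses and conjugates: applied twice, they give the equalities
  \<open>nrm_inv\<close> and \<open>nrm_conj\<close> below. In this form the axioms are easier to check for infima and limits.
\<close>

locale conj_inv_pseudonormed_group = group G for G (structure) +
  fixes nrm :: "'a \<Rightarrow> real"
  assumes nrm_nonneg: "x \<in> carrier G \<Longrightarrow> 0 \<le> nrm x"
    and nrm_one: "nrm \<one> = 0"
    and nrm_inv_le: "x \<in> carrier G \<Longrightarrow> nrm (inv x) \<le> nrm x"
    and nrm_mult: "x \<in> carrier G \<Longrightarrow> y \<in> carrier G \<Longrightarrow> nrm (x \<otimes> y) \<le> nrm x + nrm y"
    and nrm_conj_le: "x \<in> carrier G \<Longrightarrow> y \<in> carrier G \<Longrightarrow> nrm (y \<otimes> x \<otimes> inv y) \<le> nrm x"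
begin

lemma nrm_inv: "x \<in> carrier G \<Longrightarrow> nrm (inv x) = nrm x"
  using nrm_inv_le[of x] nrm_inv_le[of "inv x"] by simp

lemma nrm_conj:
  assumes "x \<in> carrier G" "y \<in> carrier G"
  shows "nrm (y \<otimes> x \<otimes> inv y) = nrm x"
proof -
  have "inv y \<otimes> (y \<otimes> x \<otimes> inv y) \<otimes> inv (inv y) = x"
    using assms by (simp add: m_assoc) (simp add: m_assoc[symmetric])
  then show ?thesis
    using nrm_conj_le[OF assms] nrm_conj_le[of "y \<otimes> x \<otimes> inv y" "inv y"] assms by simp
qed

lemma nrm_swap:
  assumes "x \<in> carrier G" "y \<in> carrier G"
  shows "nrm (x \<otimes> y) = nrm (y \<otimes> x)"
proof -
  have "x \<otimes> (y \<otimes> x) \<otimes> inv x = x \<otimes> y"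
    using assms by (simp add: m_assoc)
  then show ?thesis using nrm_conj[of "y \<otimes> x" x] assms by simp
qed

lemma abs_nrm_diff_le:
  assumes "x \<in> carrier G" "y \<in> carrier G"
  shows "\<bar>nrm x - nrm y\<bar> \<le> group_dist G nrm x y"
proof -
  have "x \<otimes> (inv x \<otimes> y) = y" "y \<otimes> inv (inv x \<otimes> y) = x"
    using assms by (simp_all add: m_assoc[symmetric] inv_mult_group)
  then show ?thesis
    using nrm_mult[of x "inv x \<otimes> y"] nrm_mult[of y "inv (inv x \<otimes> y)"] nrm_inv[of "inv x \<otimes> y"] assms
    by (simp add: group_dist_def)
qed

text \<open>
  Left and right translations are isometries, so the product may be moved one factor at a time:
  from \<open>x \<otimes> y\<close> to \<open>x' \<otimes> y\<close> and then to \<open>x' \<otimes> y'\<close>.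
\<close>

lemma group_dist_mult_le:
  assumes "x \<in> carrier G" "y \<in> carrier G" "x' \<in> carrier G" "y' \<in> carrier G"
  shows "group_dist G nrm (x \<otimes> y) (x' \<otimes> y') \<le> group_dist G nrm x x' + group_dist G nrm y y'"
proof -
  have "inv (x \<otimes> y) \<otimes> (x' \<otimes> y') = (inv y \<otimes> (inv x \<otimes> x') \<otimes> inv (inv y)) \<otimes> (inv y \<otimes> y')"
    using assms by (simp add: inv_mult_group m_assoc) (simp add: m_assoc[symmetric])
  then show ?thesis
    using nrm_mult[of "inv y \<otimes> (inv x \<otimes> x') \<otimes> inv (inv y)" "inv y \<otimes> y'"]
      nrm_conj[of "inv x \<otimes> x'" "inv y"] assms
    by (simp add: group_dist_def)
qed

lemma group_dist_inv:
  assumes "x \<in> carrier G" "y \<in> carrier G"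
  shows "group_dist G nrm (inv x) (inv y) = group_dist G nrm x y"
proof -
  have "nrm (x \<otimes> inv y) = nrm (inv (inv y \<otimes> x))"
    using assms nrm_swap[of x "inv y"] nrm_inv[of "inv y \<otimes> x"] by simp
  then show ?thesis using assms by (simp add: group_dist_def inv_mult_group)
qed

lemma pseudo_cauchy_mult:
  assumes "u \<in> T \<rightarrow> carrier G" "v \<in> T \<rightarrow> carrier G"
    and "pseudo_cauchy T (group_dist G nrm) u" "pseudo_cauchy T (group_dist G nrm) v"
  shows "pseudo_cauchy T (group_dist G nrm) (\<lambda>t. u t \<otimes> v t)"
  unfolding pseudo_cauchy_def
proof (intro allI impI)
  fix \<epsilon> :: real assume "\<epsilon> > 0"
  then have "\<epsilon> / 2 > 0" by simp
  obtain M where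
    M: "\<And>t t'. t \<in> T \<Longrightarrow> t' \<in> T \<Longrightarrow> t \<ge> M \<Longrightarrow> t' \<ge> M \<Longrightarrow> group_dist G nrm (u t) (u t') < \<epsilon> / 2"
    by (rule pseudo_cauchyE[OF assms(3) \<open>\<epsilon> / 2 > 0\<close>]) blast
  obtain N where
    N: "\<And>t t'. t \<in> T \<Longrightarrow> t' \<in> T \<Longrightarrow> t \<ge> N \<Longrightarrow> t' \<ge> N \<Longrightarrow> group_dist G nrm (v t) (v t') < \<epsilon> / 2"
    by (rule pseudo_cauchyE[OF assms(4) \<open>\<epsilon> / 2 > 0\<close>]) blast
  have "group_dist G nrm (u t \<otimes> v t) (u t' \<otimes> v t') < \<epsilon>"
    if "t \<in> T" "t' \<in> T" "t \<ge> max M N" "t' \<ge> max M N" for t t'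
  proof -
    have "u t \<in> carrier G" "v t \<in> carrier G" "u t' \<in> carrier G" "v t' \<in> carrier G"
      using that(1,2) assms(1,2) by auto
    then show ?thesis
      using group_dist_mult_le[of "u t" "v t" "u t'" "v t'"] M[of t t'] N[of t t'] that by simp
  qed
  then show "\<exists>M. \<forall>t\<in>T. \<forall>t'\<in>T. t \<ge> M \<and> t' \<ge> M \<longrightarrow> group_dist G nrm (u t \<otimes> v t) (u t' \<otimes> v t') < \<epsilon>"
    by blast
qed

lemma pseudo_cauchy_inv:
  assumes "u \<in> T \<rightarrow> carrier G" "pseudo_cauchy T (group_dist G nrm) u"
  shows "pseudo_cauchy T (group_dist G nrm) (\<lambda>t. inv (u t))"
proof -
  have "group_dist G nrm (inv (u t)) (inv (u t')) = group_dist G nrm (u t) (u t')"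
    if "t \<in> T" "t' \<in> T" for t t'
    using group_dist_inv that assms(1) by (auto simp: Pi_iff)
  then show ?thesis using assms(2) by (simp add: pseudo_cauchy_def)
qed

end

section \<open>Limits along a scaling set\<close>

abbreviation at_top_within :: "real set \<Rightarrow> real filter" where
  "at_top_within T \<equiv> inf at_top (principal T)"

lemma eventually_at_top_within:
  "eventually P (at_top_within T) \<longleftrightarrow> (\<exists>M. \<forall>t\<in>T. t \<ge> M \<longrightarrow> P t)"
  by (auto simp: eventually_inf_principal eventually_at_top_linorder)

lemma eventually_at_top_withinI: "(\<And>t. t \<in> T \<Longrightarrow> P t) \<Longrightarrow> eventually P (at_top_within T)"
  by (auto simp: eventually_at_top_within)

lemma at_top_within_neq_bot:
  assumes "scaling_set T"
  shows "at_top_within T \<noteq> bot"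
proof
  assume "at_top_within T = bot"
  then have "eventually (\<lambda>_. False) (at_top_within T)" by simp
  then obtain M where "\<And>t. t \<in> T \<Longrightarrow> \<not> t \<ge> M"
    by (auto simp only: eventually_at_top_within)
  then have "bdd_above T" by (intro bdd_aboveI[of _ M]) force
  then show False using assms by (simp add: scaling_set_def)
qed

lemma pseudo_cauchy_real_tendsto:
  fixes f :: "real \<Rightarrow> real"
  assumes T: "scaling_set T" and f: "pseudo_cauchy T dist f"
  shows "\<exists>l. (f \<longlongrightarrow> l) (at_top_within T)"
proof -
  \<comment> \<open>The limit is found along a sequence in \<open>T\<close> that tends to infinity.\<close>
  have "\<exists>t\<in>T. t \<ge> real k" for k
    using T by (meson scaling_set_def bdd_aboveI linear)
  then obtain s where s: "\<And>k. s k \<in> T" "\<And>k. s k \<ge> real k"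
    by metis
  have "Cauchy (\<lambda>k. f (s k))"
    unfolding Cauchy_def
  proof (intro allI impI)
    fix e :: real assume "e > 0"
    obtain M where M: "\<And>t t'. t \<in> T \<Longrightarrow> t' \<in> T \<Longrightarrow> t \<ge> M \<Longrightarrow> t' \<ge> M \<Longrightarrow> dist (f t) (f t') < e"
      by (rule pseudo_cauchyE[OF f \<open>e > 0\<close>]) blast
    obtain N where N: "real N \<ge> M" using real_arch_simple by blast
    have "s k \<ge> M" if "k \<ge> N" for k
      using s(2)[of k] N that by linarith
    then show "\<exists>N. \<forall>m\<ge>N. \<forall>n\<ge>N. dist (f (s m)) (f (s n)) < e"
      using M s(1) by blast
  qed
  then obtain l where l: "(\<lambda>k. f (s k)) \<longlonglongrightarrow> l"
    using Cauchy_convergent convergentD by blast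
  have "(f \<longlongrightarrow> l) (at_top_within T)"
  proof (rule tendstoI)
    fix e :: real assume "e > 0"
    then have "e / 2 > 0" by simp
    obtain M where M: "\<And>t t'. t \<in> T \<Longrightarrow> t' \<in> T \<Longrightarrow> t \<ge> M \<Longrightarrow> t' \<ge> M \<Longrightarrow> dist (f t) (f t') < e / 2"
      by (rule pseudo_cauchyE[OF f \<open>e / 2 > 0\<close>]) blast
    obtain N where N: "real N \<ge> M" using real_arch_simple by blast
    obtain N' where "\<And>k. k \<ge> N' \<Longrightarrow> dist (f (s k)) l < e / 2"
      using l \<open>e / 2 > 0\<close> unfolding lim_sequentially by blast
    then have k: "dist (f (s (max N N'))) l < e / 2" by simp
    have "s (max N N') \<ge> M"
      using s(2)[of "max N N'"] N by linarith
    then have "dist (f t) l < e" if "t \<in> T" "t \<ge> M" for t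
      using M[OF that(1) s(1) that(2)] k dist_triangle_half_l dist_commute by metis
    then show "\<forall>\<^sub>F t in at_top_within T. dist (f t) l < e"
      by (auto simp: eventually_at_top_within)
  qed
  then show ?thesis ..
qed

lemma (in conj_inv_pseudonormed_group) nrm_tendsto_Lim:
  assumes T: "scaling_set T" and u: "u \<in> T \<rightarrow> carrier G" "pseudo_cauchy T (group_dist G nrm) u"
  shows "((\<lambda>t. nrm (u t)) \<longlongrightarrow> Lim (at_top_within T) (\<lambda>t. nrm (u t))) (at_top_within T)"
proof -
  have "dist (nrm (u t)) (nrm (u t')) \<le> group_dist G nrm (u t) (u t')" if "t \<in> T" "t' \<in> T" for t t'
    using abs_nrm_diff_le[of "u t" "u t'"] u(1) that by (auto simp: dist_real_def)
  then have "pseudo_cauchy T dist (\<lambda>t. nrm (u t))"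
    by (rule pseudo_cauchy_mono[OF u(2)])
  then obtain l where l: "((\<lambda>t. nrm (u t)) \<longlongrightarrow> l) (at_top_within T)"
    using pseudo_cauchy_real_tendsto[OF T] by blast
  then show ?thesis
    using tendsto_Lim[OF at_top_within_neq_bot[OF T] l] by simp
qed

text \<open>
  The axioms of a pseudonorm are weak inequalities between finitely many values, so a pointwise
  limit of pseudonorms pulled back along homomorphisms is again a pseudonorm. For the directional
  words the homomorphisms are evaluation at \<open>t\<close> followed by scaling by \<open>1 / t\<close>.
\<close>

lemma (in conj_inv_pseudonormed_group) limit_pseudonorm:
  fixes D :: "('d, 'm) monoid_scheme"
  assumes D: "group D" and T: "scaling_set T"
    and ev: "\<And>t. t \<in> T \<Longrightarrow> ev t \<in> hom D G"
    and cauchy: "\<And>w. w \<in> carrier D \<Longrightarrow> pseudo_cauchy T (group_dist G nrm) (\<lambda>t. ev t w)"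
  shows "conj_inv_pseudonormed_group D (\<lambda>w. Lim (at_top_within T) (\<lambda>t. nrm (ev t w)))"
proof -
  interpret D: group D by (rule D)
  let ?N = "\<lambda>w. Lim (at_top_within T) (\<lambda>t. nrm (ev t w))"
  have gh: "group_hom D G (ev t)" if "t \<in> T" for t
    using that ev by (simp add: group_hom_def group_hom_axioms_def D is_group)
  have closed: "ev t w \<in> carrier G" if "t \<in> T" "w \<in> carrier D" for t w
    using ev that by (auto simp: hom_def)
  have lim: "((\<lambda>t. nrm (ev t w)) \<longlongrightarrow> ?N w) (at_top_within T)" if "w \<in> carrier D" for w
    using that closed by (intro nrm_tendsto_Lim T cauchy) auto
  note bot = at_top_within_neq_bot[OF T]
  show ?thesis
  proof
    fix x assume x: "x \<in> carrier D"
    show "0 \<le> ?N x"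
      using closed x nrm_nonneg
      by (intro tendsto_lowerbound[OF lim[OF x] _ bot] eventually_at_top_withinI) auto
    show "?N (inv\<^bsub>D\<^esub> x) \<le> ?N x"
      using closed x group_hom.hom_inv[OF gh] nrm_inv_le
      by (intro tendsto_le[OF bot lim lim] eventually_at_top_withinI) auto
    fix y assume y: "y \<in> carrier D"
    show "?N (x \<otimes>\<^bsub>D\<^esub> y) \<le> ?N x + ?N y"
      using closed x y group_hom.hom_mult[OF gh] nrm_mult
      by (intro tendsto_le[OF bot tendsto_add[OF lim lim] lim] eventually_at_top_withinI) auto
    show "?N (y \<otimes>\<^bsub>D\<^esub> x \<otimes>\<^bsub>D\<^esub> inv\<^bsub>D\<^esub> y) \<le> ?N x"
      using closed x y group_hom.hom_mult[OF gh] group_hom.hom_inv[OF gh] nrm_conj_le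
      by (intro tendsto_le[OF bot lim lim] eventually_at_top_withinI) auto
  next
    have "((\<lambda>t. nrm (ev t \<one>\<^bsub>D\<^esub>)) \<longlongrightarrow> 0) (at_top_within T)"
      using group_hom.hom_one[OF gh] nrm_one
      by (intro tendsto_eventually eventually_at_top_withinI) auto
    then show "?N \<one>\<^bsub>D\<^esub> = 0"
      by (rule tendsto_Lim[OF bot])
  qed
qed

section \<open>Images and quotients of pseudonormed groups\<close>

text \<open>
  Lifts can be inverted, multiplied and conjugated, which gives each inequality for the infimum.
  Surjectivity keeps the set of lifts nonempty; the infimum over the empty set would be arbitrary.
\<close>

lemma (in conj_inv_pseudonormed_group) pushforward_pseudonorm:
  fixes C :: "('c, 'm) monoid_scheme"
  assumes C: "group C" and p: "p \<in> hom G C" and surj: "p ` carrier G = carrier C"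
  shows "conj_inv_pseudonormed_group C (\<lambda>c. Inf {nrm w | w. w \<in> carrier G \<and> p w = c})"
proof -
  interpret C: group C by (rule C)
  interpret p: group_hom G C p
    using p by (simp add: group_hom_def group_hom_axioms_def C is_group)
  let ?N = "\<lambda>c. Inf {nrm w | w. w \<in> carrier G \<and> p w = c}"
  have lower: "?N c \<le> nrm w" if "w \<in> carrier G" "p w = c" for c w
    using that nrm_nonneg by (intro cInf_lower bdd_belowI[of _ 0]) auto
  have greatest: "a \<le> ?N c" if "c \<in> carrier C" "\<And>w. w \<in> carrier G \<Longrightarrow> p w = c \<Longrightarrow> a \<le> nrm w" for a c
  proof -
    have "c \<in> p ` carrier G"
      using that(1) surj by simp
    then have "{nrm w | w. w \<in> carrier G \<and> p w = c} \<noteq> {}"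
      by blast
    then show ?thesis by (rule cInf_greatest) (use that(2) in blast)
  qed
  have nonneg: "0 \<le> ?N c" if "c \<in> carrier C" for c
    using that nrm_nonneg by (intro greatest)
  show ?thesis
  proof
    fix x assume x: "x \<in> carrier C"
    show "0 \<le> ?N x" using nonneg[OF x] .
    show "?N (inv\<^bsub>C\<^esub> x) \<le> ?N x"
    proof (rule greatest[OF x])
      fix w assume "w \<in> carrier G" "p w = x"
      then show "?N (inv\<^bsub>C\<^esub> x) \<le> nrm w"
        using lower[of "inv w" "inv\<^bsub>C\<^esub> x"] nrm_inv[of w] by simp
    qed
    fix y assume y: "y \<in> carrier C"
    show "?N (y \<otimes>\<^bsub>C\<^esub> x \<otimes>\<^bsub>C\<^esub> inv\<^bsub>C\<^esub> y) \<le> ?N x"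
    proof (rule greatest[OF x])
      fix w assume w: "w \<in> carrier G" "p w = x"
      have "y \<in> p ` carrier G"
        using y surj by simp
      then obtain v where "v \<in> carrier G" "p v = y"
        by blast
      then show "?N (y \<otimes>\<^bsub>C\<^esub> x \<otimes>\<^bsub>C\<^esub> inv\<^bsub>C\<^esub> y) \<le> nrm w"
        using lower[of "v \<otimes> w \<otimes> inv v" "y \<otimes>\<^bsub>C\<^esub> x \<otimes>\<^bsub>C\<^esub> inv\<^bsub>C\<^esub> y"] nrm_conj[of w v] w by simp
    qed
    have "?N (x \<otimes>\<^bsub>C\<^esub> y) - nrm w \<le> ?N y" if w: "w \<in> carrier G" "p w = x" for w
    proof (rule greatest[OF y])
      fix v assume "v \<in> carrier G" "p v = y"
      then show "?N (x \<otimes>\<^bsub>C\<^esub> y) - nrm w \<le> nrm v"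
        using lower[of "w \<otimes> v" "x \<otimes>\<^bsub>C\<^esub> y"] nrm_mult[of w v] w by simp
    qed
    then have "?N (x \<otimes>\<^bsub>C\<^esub> y) - ?N y \<le> ?N x"
      by (intro greatest[OF x]) (simp add: algebra_simps)
    then show "?N (x \<otimes>\<^bsub>C\<^esub> y) \<le> ?N x + ?N y" by simp
  next
    show "?N \<one>\<^bsub>C\<^esub> = 0"
      using lower[of \<one> "\<one>\<^bsub>C\<^esub>"] nonneg[of "\<one>\<^bsub>C\<^esub>"] nrm_one by simp
  qed
qed

context conj_inv_pseudonormed_group
begin

definition null_set :: "'a set" where
  "null_set = {x \<in> carrier G. nrm x = 0}"

lemma subgroup_null_set: "subgroup null_set G"
proof (rule subgroupI)
  show "null_set \<noteq> {}" using nrm_one by (auto simp: null_set_def)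
  fix a b assume "a \<in> null_set" "b \<in> null_set"
  then show "a \<otimes> b \<in> null_set"
    using nrm_mult[of a b] nrm_nonneg[of "a \<otimes> b"] by (auto simp: null_set_def)
qed (auto simp: null_set_def nrm_inv)

lemma normal_null_set: "null_set \<lhd> G"
  using subgroup_null_set by (auto simp: normal_inv_iff null_set_def nrm_conj)

lemma nrm_eq_on_coset:
  assumes "x \<in> carrier G" "y \<in> null_set #> x"
  shows "nrm y = nrm x"
proof -
  obtain h where h: "h \<in> carrier G" "nrm h = 0" "y = h \<otimes> x"
    using assms(2) by (auto simp: r_coset_def null_set_def)
  have "x = inv h \<otimes> (h \<otimes> x)"
    using h assms(1) by (simp add: m_assoc[symmetric])
  then show ?thesis
    using nrm_mult[of h x] nrm_mult[of "inv h" "h \<otimes> x"] nrm_inv[of h] h assms(1) by simp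
qed

lemma rcos_null_set_self: "x \<in> carrier G \<Longrightarrow> x \<in> null_set #> x"
  by (rule rcos_self[OF _ subgroup_null_set])

lemma quotient_nrm:
  assumes "x \<in> carrier G"
  shows "the_elem (nrm ` (null_set #> x)) = nrm x"
  using rcos_null_set_self[OF assms] nrm_eq_on_coset[OF assms]
  by (intro the_elem_image_unique) blast+

lemma rcos_null_set_eq_iff_nrm_0:
  assumes "x \<in> carrier G"
  shows "null_set #> x = null_set \<longleftrightarrow> nrm x = 0"
proof -
  have "null_set #> x = null_set \<longleftrightarrow> x \<in> null_set"
    using coset_join1[OF _ assms subgroup_null_set] coset_join2[OF assms subgroup_null_set] by metis
  then show ?thesis using assms by (simp add: null_set_def)
qed

text \<open>
  In the target \<open>m\<close> vanishes only at the unit, and \<open>f\<close> carries \<open>nrm\<close> to \<open>m\<close>, so the kernel of \<open>f\<close> is \<open>null_set\<close> and the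
  first isomorphism theorem applies. The second part records that the isomorphism sends the
  class of \<open>x\<close> to \<open>f x\<close>.
\<close>

lemma isometric_iso_quotient:
  fixes L :: "('c, 'k) monoid_scheme"
  assumes L: "group L" and f: "f \<in> hom G L" and surj: "f ` carrier G = carrier L"
    and isometric: "\<And>x. x \<in> carrier G \<Longrightarrow> m (f x) = nrm x"
    and m_0: "\<And>y. y \<in> carrier L \<Longrightarrow> m y = 0 \<longleftrightarrow> y = \<one>\<^bsub>L\<^esub>"
  shows "(\<lambda>X. the_elem (f ` X)) \<in>
           isometric_iso (G Mod null_set) (\<lambda>X. the_elem (nrm ` X)) L m"
    and "x \<in> carrier G \<Longrightarrow> the_elem (f ` (null_set #> x)) = f x"
proof -
  interpret f: group_hom G L f
    using f by (simp add: group_hom_def group_hom_axioms_def L is_group)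
  have kernel: "kernel G L f = null_set"
    using m_0[OF f.hom_closed] isometric by (auto simp: kernel_def null_set_def)
  have f_const: "f y = f x" if "x \<in> carrier G" "y \<in> null_set #> x" for x y
    using that unfolding kernel[symmetric] by (auto simp: r_coset_def kernel_def)
  have val: "the_elem (f ` (null_set #> x)) = f x" if "x \<in> carrier G" for x
    using rcos_null_set_self[OF that] f_const[OF that] by (intro the_elem_image_unique) blast+
  then show "x \<in> carrier G \<Longrightarrow> the_elem (f ` (null_set #> x)) = f x" .
  interpret Q: group "G Mod null_set"
    using normal_null_set by (rule normal.factorgroup_is_group)
  let ?F = "\<lambda>X. the_elem (f ` X)"
  have iso: "?F \<in> iso (G Mod null_set) L"
    using f.FactGroup_iso_set[OF surj] unfolding kernel .
  then interpret F: group_hom "G Mod null_set" L ?F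
    by (simp add: group_hom_def group_hom_axioms_def L Q.is_group iso_def)
  have nrm: "m (?F X) = the_elem (nrm ` X)" if "X \<in> carrier (G Mod null_set)" for X
    using that val quotient_nrm isometric by (auto simp: carrier_FactGroup)
  \<comment> \<open>A homomorphism that preserves norms preserves the distances they induce.\<close>
  have "group_dist L m (?F X) (?F Y) = group_dist (G Mod null_set) (\<lambda>X. the_elem (nrm ` X)) X Y"
    if XY: "X \<in> carrier (G Mod null_set)" "Y \<in> carrier (G Mod null_set)" for X Y
  proof -
    have "inv\<^bsub>L\<^esub> ?F X \<otimes>\<^bsub>L\<^esub> ?F Y = ?F (inv\<^bsub>G Mod null_set\<^esub> X \<otimes>\<^bsub>G Mod null_set\<^esub> Y)"
      using XY by (simp only: F.hom_mult F.hom_inv Q.inv_closed)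
    then show ?thesis
      using nrm[OF Q.m_closed[OF Q.inv_closed[OF XY(1)] XY(2)]] unfolding group_dist_def by (simp only:)
  qed
  then show "?F \<in> isometric_iso (G Mod null_set) (\<lambda>X. the_elem (nrm ` X)) L m"
    using iso by (auto simp: isometric_iso_def)
qed

end

section \<open>The pseudonorm of the free product\<close>

lemma FR_carrier: "carrier (FR G) = reduced_words (carrier G) UNIV"
  by (simp add: real_free_product_def)

lemma FR_one: "\<one>\<^bsub>FR G\<^esub> = []"
  by (simp add: real_free_product_def)

lemma letter_0: "letter g 0 = []"
  by (simp add: letter_def)

lemma inv_letter:
  assumes "g \<in> I"
  shows "inv\<^bsub>real_free_product I\<^esub> (letter g r) = letter g (- r)"
proof -
  interpret group "real_free_product I" by (rule group_real_free_product)
  have "letter g (- r) \<otimes>\<^bsub>real_free_product I\<^esub> letter g r = \<one>\<^bsub>real_free_product I\<^esub>"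
    by (simp add: letter_add letter_0) (simp add: real_free_product_def)
  then show ?thesis
    using assms by (intro inv_equality) (auto simp: letter_in_real_free_product)
qed

lemma FR_induct [consumes 1, case_names one mult]:
  assumes "x \<in> carrier (FR G)"
    and "P \<one>\<^bsub>FR G\<^esub>"
    and "\<And>g r y. g \<in> carrier G \<Longrightarrow> y \<in> carrier (FR G) \<Longrightarrow> P y \<Longrightarrow> P (letter g r \<otimes>\<^bsub>FR G\<^esub> y)"
  shows "P x"
  using assms(1)
proof (induction x)
  case Nil
  then show ?case using assms(2) by (simp add: FR_one)
next
  case (Cons a w)
  obtain g r where a: "a = (g, r)" by (cases a)
  have w: "w \<in> carrier (FR G)" "g \<in> carrier G" "r \<noteq> 0" and hd: "w = [] \<or> g \<noteq> fst (hd w)"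
    using Cons.prems a by (simp_all add: FR_carrier reduced_words_Cons)
  have "letter_cons (g, r) w = (g, r) # w"
    using w(3) hd by (cases w) auto
  then have "letter g r \<otimes>\<^bsub>FR G\<^esub> w = a # w"
    using w(3) a by (simp add: letter_def real_free_product_def)
  then show ?case
    using assms(3)[OF w(2,1) Cons.IH[OF w(1)], of r] by simp
qed

text \<open>
  The letters generate the free product.
\<close>

lemma FR_hom_eqI:
  assumes K: "group K" and h: "h \<in> hom (FR G) K" and k: "k \<in> hom (FR G) K"
    and eq: "\<And>g r. g \<in> carrier G \<Longrightarrow> h (letter g r) = k (letter g r)"
    and x: "x \<in> carrier (FR G)"
  shows "h x = k x"
proof -
  interpret h: group_hom "FR G" K h
    using h K by (simp add: group_hom_def group_hom_axioms_def group_real_free_product)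
  interpret k: group_hom "FR G" K k
    using k K by (simp add: group_hom_def group_hom_axioms_def group_real_free_product)
  show ?thesis
    using x by (induction rule: FR_induct) (simp_all add: eq letter_in_real_free_product)
qed

text \<open>
  In \<open>conj_product G n x c\<close> the number \<open>c\<close> is the weight of one way to write \<open>x\<close> as a product of
  conjugates of letters, so \<open>FR_norm\<close> is the infimum of these weights. Exponents \<open>-1\<close> are absent, because the inverse of
  \<open>letter g r\<close> is \<open>letter g (- r)\<close>, which has the same weight. The inductive form makes
  each estimate of \<open>FR_norm\<close> an induction on the number of factors.
\<close>

inductive conj_product ::
  "('a, 'm) monoid_scheme \<Rightarrow> ('a \<Rightarrow> real) \<Rightarrow> ('a \<times> real) list \<Rightarrow> real \<Rightarrow> bool" for G n where
  one: "conj_product G n \<one>\<^bsub>FR G\<^esub> 0"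
| step: "h \<in> carrier (FR G) \<Longrightarrow> g \<in> carrier G \<Longrightarrow> conj_product G n y c \<Longrightarrow>
    conj_product G n (h \<otimes>\<^bsub>FR G\<^esub> letter g r \<otimes>\<^bsub>FR G\<^esub> inv\<^bsub>FR G\<^esub> h \<otimes>\<^bsub>FR G\<^esub> y) (\<bar>r\<bar> * n g + c)"

lemma list_prod_Nil: "list_prod K [] = \<one>\<^bsub>K\<^esub>"
  and list_prod_Cons: "list_prod K (x # xs) = x \<otimes>\<^bsub>K\<^esub> list_prod K xs"
  by (simp_all add: list_prod_def)

lemma conj_product_iff_list:
  "conj_product G n x c \<longleftrightarrow>
     (\<exists>L :: (('a \<times> real) list \<times> 'a \<times> real \<times> int) list.
        c = (\<Sum>(h, g, r, e) \<leftarrow> L. \<bar>r\<bar> * n g) \<and>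
        set L \<subseteq> carrier (FR G) \<times> carrier G \<times> UNIV \<times> {1, -1} \<and>
        x = list_prod (FR G)
              (map (\<lambda>(h, g, r, e).
                 h \<otimes>\<^bsub>FR G\<^esub> (letter g r [^]\<^bsub>FR G\<^esub> e) \<otimes>\<^bsub>FR G\<^esub> inv\<^bsub>FR G\<^esub> h) L))"
  (is "_ \<longleftrightarrow> (\<exists>L. ?Q L x c)")
proof
  interpret FR: group "FR G" by (rule group_real_free_product)
  have pow: "letter g r [^]\<^bsub>FR G\<^esub> (1::int) = letter g r"
    "letter g r [^]\<^bsub>FR G\<^esub> (-1::int) = letter g (- r)" if "g \<in> carrier G" for g r
    using that by (simp_all add: FR.int_pow_neg FR.int_pow_1 inv_letter letter_in_real_free_product)
  {
    assume "conj_product G n x c"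
    then show "\<exists>L. ?Q L x c"
    proof induction
      case one
      show ?case by (intro exI[of _ "[]"]) (simp add: list_prod_Nil)
    next
      case (step h g y c r)
      then obtain L where L: "?Q L y c" by blast
      have "?Q ((h, g, r, 1) # L) (h \<otimes>\<^bsub>FR G\<^esub> letter g r \<otimes>\<^bsub>FR G\<^esub> inv\<^bsub>FR G\<^esub> h \<otimes>\<^bsub>FR G\<^esub> y) (\<bar>r\<bar> * n g + c)"
        using step.hyps L by (simp add: pow list_prod_Cons)
      then show ?case by blast
    qed
  }
  assume "\<exists>L. ?Q L x c"
  then obtain L where "?Q L x c" by blast
  then show "conj_product G n x c"
  proof (induction L arbitrary: x c)
    case Nil
    then show ?case using conj_product.one by (simp add: list_prod_Nil)
  next
    case (Cons a L)
    obtain h g r e where a: "a = (h, g, r, e)" by (cases a)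
    define y d where "y = list_prod (FR G) (map (\<lambda>(h, g, r, e).
        h \<otimes>\<^bsub>FR G\<^esub> (letter g r [^]\<^bsub>FR G\<^esub> e) \<otimes>\<^bsub>FR G\<^esub> inv\<^bsub>FR G\<^esub> h) L)"
      and "d = (\<Sum>(h, g, r, e) \<leftarrow> L. \<bar>r\<bar> * n g)"
    have hg: "h \<in> carrier (FR G)" "g \<in> carrier G" "e = 1 \<or> e = -1"
      using Cons.prems a by auto
    have "conj_product G n y d"
      using Cons by (simp add: y_def d_def)
    then have step: "conj_product G n (h \<otimes>\<^bsub>FR G\<^esub> letter g s \<otimes>\<^bsub>FR G\<^esub> inv\<^bsub>FR G\<^esub> h \<otimes>\<^bsub>FR G\<^esub> y) (\<bar>s\<bar> * n g + d)" for s
      using hg by (intro conj_product.step)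
    have "x = h \<otimes>\<^bsub>FR G\<^esub> (letter g r [^]\<^bsub>FR G\<^esub> e) \<otimes>\<^bsub>FR G\<^esub> inv\<^bsub>FR G\<^esub> h \<otimes>\<^bsub>FR G\<^esub> y" "c = \<bar>r\<bar> * n g + d"
      using Cons.prems a by (simp_all add: list_prod_Cons y_def d_def)
    then show ?case
      using hg step[of r] step[of "- r"] by (auto simp: pow)
  qed
qed

lemma FR_norm_eq_Inf: "FR_norm G n x = Inf {c. conj_product G n x c}"
  unfolding FR_norm_def conj_product_iff_list by metis

context
  fixes G :: "('a, 'm) monoid_scheme" and n :: "'a \<Rightarrow> real"
begin

interpretation FR: group "FR G" by (rule group_real_free_product)

lemma conj_product_closed: "conj_product G n x c \<Longrightarrow> x \<in> carrier (FR G)"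
  by (induction rule: conj_product.induct) (simp_all add: letter_in_real_free_product)

lemma conj_product_mult:
  assumes "conj_product G n x c" "conj_product G n y d"
  shows "conj_product G n (x \<otimes>\<^bsub>FR G\<^esub> y) (c + d)"
  using assms(1)
proof induction
  case one
  then show ?case using assms(2) conj_product_closed by simp
next
  case (step h g z c r)
  have "h \<otimes>\<^bsub>FR G\<^esub> letter g r \<otimes>\<^bsub>FR G\<^esub> inv\<^bsub>FR G\<^esub> h \<otimes>\<^bsub>FR G\<^esub> z \<otimes>\<^bsub>FR G\<^esub> y
      = h \<otimes>\<^bsub>FR G\<^esub> letter g r \<otimes>\<^bsub>FR G\<^esub> inv\<^bsub>FR G\<^esub> h \<otimes>\<^bsub>FR G\<^esub> (z \<otimes>\<^bsub>FR G\<^esub> y)"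
    using step.hyps assms(2) by (simp add: FR.m_assoc conj_product_closed letter_in_real_free_product)
  then show ?case
    using conj_product.step[OF step.hyps(1,2) step.IH, of r] by (simp add: add.assoc)
qed

lemma conj_product_conj_letter:
  assumes "h \<in> carrier (FR G)" "g \<in> carrier G"
  shows "conj_product G n (h \<otimes>\<^bsub>FR G\<^esub> letter g r \<otimes>\<^bsub>FR G\<^esub> inv\<^bsub>FR G\<^esub> h) (\<bar>r\<bar> * n g)"
  using conj_product.step[OF assms conj_product.one, of n r] assms
  by (simp add: letter_in_real_free_product)

lemma conj_product_inv:
  assumes "conj_product G n x c"
  shows "conj_product G n (inv\<^bsub>FR G\<^esub> x) c"
  using assms
proof induction
  case one
  then show ?case using conj_product.one[of G n] by simp
next
  case (step h g y c r)
  have "inv\<^bsub>FR G\<^esub> (h \<otimes>\<^bsub>FR G\<^esub> letter g r \<otimes>\<^bsub>FR G\<^esub> inv\<^bsub>FR G\<^esub> h \<otimes>\<^bsub>FR G\<^esub> y)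
      = inv\<^bsub>FR G\<^esub> y \<otimes>\<^bsub>FR G\<^esub> (h \<otimes>\<^bsub>FR G\<^esub> letter g (- r) \<otimes>\<^bsub>FR G\<^esub> inv\<^bsub>FR G\<^esub> h)"
    using step.hyps
    by (simp add: FR.inv_mult_group FR.m_assoc conj_product_closed letter_in_real_free_product inv_letter)
  then show ?case
    using conj_product_mult[OF step.IH conj_product_conj_letter[OF step.hyps(1,2), of "- r"]]
    by (simp add: add.commute)
qed

lemma conj_product_conj:
  assumes "conj_product G n x c" and k: "k \<in> carrier (FR G)"
  shows "conj_product G n (k \<otimes>\<^bsub>FR G\<^esub> x \<otimes>\<^bsub>FR G\<^esub> inv\<^bsub>FR G\<^esub> k) c"
  using assms(1)
proof induction
  case one
  then show ?case using conj_product.one[of G n] k by simp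
next
  case (step h g y c r)
  have cancel: "inv\<^bsub>FR G\<^esub> k \<otimes>\<^bsub>FR G\<^esub> (k \<otimes>\<^bsub>FR G\<^esub> z) = z" if "z \<in> carrier (FR G)" for z
    using that k by (simp add: FR.m_assoc[symmetric])
  have "k \<otimes>\<^bsub>FR G\<^esub> (h \<otimes>\<^bsub>FR G\<^esub> letter g r \<otimes>\<^bsub>FR G\<^esub> inv\<^bsub>FR G\<^esub> h \<otimes>\<^bsub>FR G\<^esub> y) \<otimes>\<^bsub>FR G\<^esub> inv\<^bsub>FR G\<^esub> k
      = (k \<otimes>\<^bsub>FR G\<^esub> h) \<otimes>\<^bsub>FR G\<^esub> letter g r \<otimes>\<^bsub>FR G\<^esub> inv\<^bsub>FR G\<^esub> (k \<otimes>\<^bsub>FR G\<^esub> h)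
          \<otimes>\<^bsub>FR G\<^esub> (k \<otimes>\<^bsub>FR G\<^esub> y \<otimes>\<^bsub>FR G\<^esub> inv\<^bsub>FR G\<^esub> k)"
    using step.hyps k
    by (simp add: FR.inv_mult_group FR.m_assoc conj_product_closed letter_in_real_free_product cancel)
  then show ?case
    using conj_product.step[OF _ step.hyps(2) step.IH, of "k \<otimes>\<^bsub>FR G\<^esub> h" r] step.hyps(1) k by simp
qed

lemma conj_product_exists:
  assumes "x \<in> carrier (FR G)"
  shows "\<exists>c. conj_product G n x c"
  using assms
proof (induction rule: FR_induct)
  case one
  then show ?case using conj_product.one by blast
next
  case (mult g r y)
  then obtain c where "conj_product G n y c" by blast
  from conj_product.step[OF FR.one_closed mult.hyps(1) this, of r] show ?case
    using mult.hyps by (auto simp: letter_in_real_free_product)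
qed

lemma FR_norm_greatest:
  assumes "x \<in> carrier (FR G)" "\<And>c. conj_product G n x c \<Longrightarrow> a \<le> c"
  shows "a \<le> FR_norm G n x"
  unfolding FR_norm_eq_Inf using conj_product_exists[OF assms(1)] assms(2)
  by (intro cInf_greatest) auto

context
  assumes n_nonneg: "\<And>g. g \<in> carrier G \<Longrightarrow> 0 \<le> n g"
begin

lemma conj_product_nonneg: "conj_product G n x c \<Longrightarrow> 0 \<le> c"
  by (induction rule: conj_product.induct) (simp_all add: n_nonneg)

lemma FR_norm_lower: "conj_product G n x c \<Longrightarrow> FR_norm G n x \<le> c"
  unfolding FR_norm_eq_Inf using conj_product_nonneg
  by (intro cInf_lower bdd_belowI[of _ 0]) auto

lemma FR_norm_pseudonorm: "conj_inv_pseudonormed_group (FR G) (FR_norm G n)"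
proof
  fix x assume x: "x \<in> carrier (FR G)"
  show "0 \<le> FR_norm G n x"
    using conj_product_nonneg by (rule FR_norm_greatest[OF x])
  show "FR_norm G n (inv\<^bsub>FR G\<^esub> x) \<le> FR_norm G n x"
    using FR_norm_lower[OF conj_product_inv] by (rule FR_norm_greatest[OF x])
  fix y assume y: "y \<in> carrier (FR G)"
  show "FR_norm G n (y \<otimes>\<^bsub>FR G\<^esub> x \<otimes>\<^bsub>FR G\<^esub> inv\<^bsub>FR G\<^esub> y) \<le> FR_norm G n x"
    using FR_norm_lower[OF conj_product_conj[OF _ y]] by (rule FR_norm_greatest[OF x])
  have "FR_norm G n (x \<otimes>\<^bsub>FR G\<^esub> y) - c \<le> FR_norm G n y" if c: "conj_product G n x c" for c
  proof (rule FR_norm_greatest[OF y])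
    fix d assume "conj_product G n y d"
    then show "FR_norm G n (x \<otimes>\<^bsub>FR G\<^esub> y) - c \<le> d"
      using FR_norm_lower[OF conj_product_mult[OF c]] by fastforce
  qed
  then have "FR_norm G n (x \<otimes>\<^bsub>FR G\<^esub> y) - FR_norm G n y \<le> FR_norm G n x"
    by (intro FR_norm_greatest[OF x]) (simp add: algebra_simps)
  then show "FR_norm G n (x \<otimes>\<^bsub>FR G\<^esub> y) \<le> FR_norm G n x + FR_norm G n y" by simp
next
  show "FR_norm G n \<one>\<^bsub>FR G\<^esub> = 0"
    using FR_norm_lower[OF conj_product.one] FR_norm_greatest[OF FR.one_closed conj_product_nonneg]
    by (rule antisym)
qed

end

end

section \<open>Functoriality of the free product\<close>

definition FR_map :: "('b, 'k) monoid_scheme \<Rightarrow> ('a \<Rightarrow> 'b) \<Rightarrow> ('a \<times> real) list \<Rightarrow> ('b \<times> real) list" where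
  "FR_map H f = word_eval (FR H) (\<lambda>g r. letter (f g) r)"

context
  fixes G :: "('a, 'm) monoid_scheme" and H :: "('b, 'k) monoid_scheme" and f :: "'a \<Rightarrow> 'b"
  assumes f: "f \<in> carrier G \<rightarrow> carrier H"
begin

interpretation FG: group "FR G" by (rule group_real_free_product)
interpretation FH: group "FR H" by (rule group_real_free_product)

lemma FR_map_hom: "FR_map H f \<in> hom (FR G) (FR H)"
  unfolding FR_map_def
proof (rule homI)
  fix x y assume "x \<in> carrier (FR G)" "y \<in> carrier (FR G)"
  then show "word_eval (FR H) (\<lambda>g r. letter (f g) r) (x \<otimes>\<^bsub>FR G\<^esub> y) =
      word_eval (FR H) (\<lambda>g r. letter (f g) r) x \<otimes>\<^bsub>FR H\<^esub> word_eval (FR H) (\<lambda>g r. letter (f g) r) y"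
    unfolding FR_carrier using f
    by (intro word_eval_mult[where S = UNIV and I = "carrier G"])
      (auto simp: letter_in_real_free_product letter_add FH.is_group Pi_iff)
next
  fix x assume "x \<in> carrier (FR G)"
  then show "word_eval (FR H) (\<lambda>g r. letter (f g) r) x \<in> carrier (FR H)"
    using f by (intro word_eval_closed[where S = UNIV and I = "carrier G"])
      (auto simp: FR_carrier[symmetric] letter_in_real_free_product letter_add FH.is_group Pi_iff)
qed

lemma FR_map_letter:
  assumes "g \<in> carrier G"
  shows "FR_map H f (letter g r) = letter (f g) r"
  unfolding FR_map_def using f assms
  by (intro word_eval_letter[where S = UNIV and I = "carrier G"])
    (auto simp: letter_in_real_free_product letter_add FH.is_group Pi_iff)

interpretation FR_map: group_hom "FR G" "FR H" "FR_map H f"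
  by (simp add: group_hom_def group_hom_axioms_def FR_map_hom FG.is_group FH.is_group)

lemma FR_map_scale_hom:
  assumes "x \<in> carrier (FR G)"
  shows "FR_map H f (scale_hom G t x) = scale_hom H t (FR_map H f x)"
proof -
  have "(FR_map H f \<circ> scale_hom G t) x = (scale_hom H t \<circ> FR_map H f) x"
  proof (rule FR_hom_eqI[OF FH.is_group _ _ _ assms])
    show "FR_map H f \<circ> scale_hom G t \<in> hom (FR G) (FR H)"
      using scale_hom_hom FR_map_hom by (rule hom_compose)
    show "scale_hom H t \<circ> FR_map H f \<in> hom (FR G) (FR H)"
      using FR_map_hom scale_hom_hom by (rule hom_compose)
  next
    fix g r assume g: "g \<in> carrier G"
    then have "f g \<in> carrier H" using f by auto
    then show "(FR_map H f \<circ> scale_hom G t) (letter g r) = (scale_hom H t \<circ> FR_map H f) (letter g r)"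
      using g by (simp add: scale_hom_letter FR_map_letter)
  qed
  then show ?thesis by simp
qed

end

lemma FR_norm_conj_letter_mult_le:
  assumes n_nonneg: "\<And>g. g \<in> carrier G \<Longrightarrow> 0 \<le> n g"
    and h: "h \<in> carrier (FR G)" and g: "g \<in> carrier G" and y: "y \<in> carrier (FR G)"
  shows "FR_norm G n (h \<otimes>\<^bsub>FR G\<^esub> letter g r \<otimes>\<^bsub>FR G\<^esub> inv\<^bsub>FR G\<^esub> h \<otimes>\<^bsub>FR G\<^esub> y) \<le> \<bar>r\<bar> * n g + FR_norm G n y"
proof -
  interpret N: conj_inv_pseudonormed_group "FR G" "FR_norm G n"
    using n_nonneg by (rule FR_norm_pseudonorm)
  have "FR_norm G n (h \<otimes>\<^bsub>FR G\<^esub> letter g r \<otimes>\<^bsub>FR G\<^esub> inv\<^bsub>FR G\<^esub> h) \<le> \<bar>r\<bar> * n g"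
    using FR_norm_lower[OF n_nonneg conj_product_conj_letter[OF h g]] .
  then show ?thesis
    using N.nrm_mult[of "h \<otimes>\<^bsub>FR G\<^esub> letter g r \<otimes>\<^bsub>FR G\<^esub> inv\<^bsub>FR G\<^esub> h" y] h g y
    by (simp add: letter_in_real_free_product)
qed

text \<open>
  Each factor of a product of conjugates is mapped to a conjugate of a letter in both
  targets, at a total weight not exceeding its own in the source.
\<close>

lemma FR_norm_FR_map_add_le:
  fixes G :: "('a, 'm) monoid_scheme" and H :: "('b, 'k) monoid_scheme" and K :: "('c, 'l) monoid_scheme"
  assumes f: "f \<in> carrier G \<rightarrow> carrier H" and f': "f' \<in> carrier G \<rightarrow> carrier K"
    and nH: "\<And>h. h \<in> carrier H \<Longrightarrow> 0 \<le> nH h" and nK: "\<And>k. k \<in> carrier K \<Longrightarrow> 0 \<le> nK k"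
    and le: "\<And>g. g \<in> carrier G \<Longrightarrow> nH (f g) + nK (f' g) \<le> nG g"
    and x: "x \<in> carrier (FR G)"
  shows "FR_norm H nH (FR_map H f x) + FR_norm K nK (FR_map K f' x) \<le> FR_norm G nG x"
proof (rule FR_norm_greatest[OF x])
  fix c assume c: "conj_product G nG x c"
  interpret FG: group "FR G" by (rule group_real_free_product)
  interpret H: conj_inv_pseudonormed_group "FR H" "FR_norm H nH"
    using nH by (rule FR_norm_pseudonorm)
  interpret K: conj_inv_pseudonormed_group "FR K" "FR_norm K nK"
    using nK by (rule FR_norm_pseudonorm)
  interpret f: group_hom "FR G" "FR H" "FR_map H f"
    using FR_map_hom[OF f] by (simp add: group_hom_def group_hom_axioms_def FG.is_group H.is_group)
  interpret f': group_hom "FR G" "FR K" "FR_map K f'"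
    using FR_map_hom[OF f'] by (simp add: group_hom_def group_hom_axioms_def FG.is_group K.is_group)
  show "FR_norm H nH (FR_map H f x) + FR_norm K nK (FR_map K f' x) \<le> c"
    using c
  proof induction
    case one
    then show ?case by (simp add: H.nrm_one K.nrm_one)
  next
    case (step h g y c r)
    have y: "y \<in> carrier (FR G)" using step.hyps(3) by (rule conj_product_closed)
    have fg: "f g \<in> carrier H" "f' g \<in> carrier K"
      using f f' step.hyps(2) by auto
    have "FR_norm H nH (FR_map H f (h \<otimes>\<^bsub>FR G\<^esub> letter g r \<otimes>\<^bsub>FR G\<^esub> inv\<^bsub>FR G\<^esub> h \<otimes>\<^bsub>FR G\<^esub> y))
        \<le> \<bar>r\<bar> * nH (f g) + FR_norm H nH (FR_map H f y)"
      using FR_norm_conj_letter_mult_le[where G = H and n = nH, OF nH, where h = "FR_map H f h" and g = "f g" and y = "FR_map H f y" and r = r] step.hyps(1,2) y fg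
      by (simp add: letter_in_real_free_product FR_map_letter[OF f])
    moreover have "FR_norm K nK (FR_map K f' (h \<otimes>\<^bsub>FR G\<^esub> letter g r \<otimes>\<^bsub>FR G\<^esub> inv\<^bsub>FR G\<^esub> h \<otimes>\<^bsub>FR G\<^esub> y))
        \<le> \<bar>r\<bar> * nK (f' g) + FR_norm K nK (FR_map K f' y)"
      using FR_norm_conj_letter_mult_le[where G = K and n = nK, OF nK, where h = "FR_map K f' h" and g = "f' g" and y = "FR_map K f' y" and r = r] step.hyps(1,2) y fg
      by (simp add: letter_in_real_free_product FR_map_letter[OF f'])
    moreover have "\<bar>r\<bar> * nH (f g) + \<bar>r\<bar> * nK (f' g) \<le> \<bar>r\<bar> * nG g"
      using mult_left_mono[OF le[OF step.hyps(2)], of "\<bar>r\<bar>"] by (simp add: distrib_left)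
    ultimately show ?case using step.IH by linarith
  qed
qed

text \<open>
  The case of one target is that of two equal targets, the second one weighted by the zero function.
\<close>

lemma FR_norm_FR_map_le:
  assumes f: "f \<in> carrier G \<rightarrow> carrier H"
    and n_nonneg: "\<And>h. h \<in> carrier H \<Longrightarrow> 0 \<le> nH h"
    and le: "\<And>g. g \<in> carrier G \<Longrightarrow> nH (f g) \<le> nG g"
    and x: "x \<in> carrier (FR G)"
  shows "FR_norm H nH (FR_map H f x) \<le> FR_norm G nG x"
proof -
  interpret Z: conj_inv_pseudonormed_group "FR H" "FR_norm H (\<lambda>_. 0)"
    by (rule FR_norm_pseudonorm) simp
  have "FR_map H f x \<in> carrier (FR H)"
    using FR_map_hom[OF f] x by (auto simp: hom_def)
  then show ?thesis
    using FR_norm_FR_map_add_le[OF f f, where nH = nH and nK = "\<lambda>_. 0" and nG = nG and x = x] n_nonneg le x Z.nrm_nonneg[of "FR_map H f x"]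
    by simp
qed

section \<open>The integral free group\<close>

lemma letter_1_in_FZ:
  assumes "g \<in> carrier G"
  shows "letter g 1 \<in> carrier (FZ G)"
  unfolding FZ_def carrier_subgroup_generated using assms
  by (intro generate.incl) (simp add: letter_in_real_free_product)

lemma FZ_subset_FR: "carrier (FZ G) \<subseteq> carrier (FR G)"
  unfolding FZ_def by (rule group.carrier_subgroup_generated_subset[OF group_real_free_product])

lemma FZ_in_FR: "x \<in> carrier (FZ G) \<Longrightarrow> x \<in> carrier (FR G)"
  using FZ_subset_FR by blast

lemma group_FZ: "group (FZ G)"
  unfolding FZ_def by (rule group.group_subgroup_generated[OF group_real_free_product])

lemma mult_FZ: "(\<otimes>\<^bsub>FZ G\<^esub>) = (\<otimes>\<^bsub>FR G\<^esub>)" and one_FZ: "\<one>\<^bsub>FZ G\<^esub> = \<one>\<^bsub>FR G\<^esub>"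
  by (simp_all add: FZ_def)

lemma inv_FZ: "x \<in> carrier (FZ G) \<Longrightarrow> inv\<^bsub>FZ G\<^esub> x = inv\<^bsub>FR G\<^esub> x"
  unfolding FZ_def by (rule group.inv_subgroup_generated[OF group_real_free_product])

lemma FZ_induct [consumes 1, case_names one letter inv mult]:
  assumes x: "x \<in> carrier (FZ G)"
    and one: "P \<one>\<^bsub>FZ G\<^esub>"
    and letter: "\<And>g. g \<in> carrier G \<Longrightarrow> P (letter g 1)"
    and inv: "\<And>g. g \<in> carrier G \<Longrightarrow> P (letter g 1) \<Longrightarrow> P (inv\<^bsub>FZ G\<^esub> (letter g 1))"
    and mult: "\<And>y z. y \<in> carrier (FZ G) \<Longrightarrow> z \<in> carrier (FZ G) \<Longrightarrow> P y \<Longrightarrow> P z \<Longrightarrow> P (y \<otimes>\<^bsub>FZ G\<^esub> z)"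
  shows "P x"
proof -
  have "x \<in> generate (FR G) (carrier (FR G) \<inter> (\<lambda>g. letter g 1) ` carrier G)"
    using x by (simp add: FZ_def carrier_subgroup_generated)
  then show ?thesis
  proof induction
    case (inv h)
    then obtain g where g: "g \<in> carrier G" "h = letter g 1" by blast
    then show ?case using assms(4)[OF g(1)] letter inv_FZ letter_1_in_FZ by metis
  next
    case (eng h1 h2)
    then show ?case using mult[of h1 h2] by (simp add: FZ_def carrier_subgroup_generated)
  qed (use one letter one_FZ in \<open>auto simp: one_FZ\<close>)
qed

lemma FR_map_FZ_hom:
  assumes f: "f \<in> carrier G \<rightarrow> carrier H"
  shows "FR_map H f \<in> hom (FZ G) (FZ H)"
proof -
  interpret f: group_hom "FR G" "FR H" "FR_map H f"
    using FR_map_hom[OF f] by (simp add: group_hom_def group_hom_axioms_def group_real_free_product)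
  interpret ZG: group "FZ G" by (rule group_FZ)
  interpret ZH: group "FZ H" by (rule group_FZ)
  have "FR_map H f x \<in> carrier (FZ H)" if "x \<in> carrier (FZ G)" for x
    using that
  proof (induction rule: FZ_induct)
    case one
    then show ?case using ZH.one_closed by (simp add: one_FZ)
  next
    case (letter g)
    then show ?case using f by (auto simp: Pi_iff letter_1_in_FZ FR_map_letter[OF f])
  next
    case (inv g)
    have "FR_map H f (inv\<^bsub>FZ G\<^esub> (letter g 1)) = inv\<^bsub>FZ H\<^esub> (FR_map H f (letter g 1))"
      using inv by (simp add: inv_FZ letter_1_in_FZ letter_in_real_free_product)
    then show ?case using inv(2) by simp
  next
    case (mult y z)
    then have "FR_map H f (y \<otimes>\<^bsub>FZ G\<^esub> z) = FR_map H f y \<otimes>\<^bsub>FZ H\<^esub> FR_map H f z"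
      by (simp add: mult_FZ FZ_in_FR)
    then show ?case using mult by simp
  qed
  then show ?thesis
    by (intro homI) (simp_all add: mult_FZ FZ_in_FR)
qed

text \<open>
  Both sides are homomorphisms on the free group generated by the letters \<open>letter g 1\<close>, and they agree on
  these generators.
\<close>

lemma FZ_proj_FR_map:
  assumes G: "group G" and H: "group H" and f: "f \<in> hom G H" and x: "x \<in> carrier (FZ G)"
  shows "FZ_proj H (FR_map H f x) = f (FZ_proj G x)"
proof -
  have fc: "f \<in> carrier G \<rightarrow> carrier H" using f by (simp add: hom_def)
  have "FZ_proj H \<circ> FR_map H f \<in> hom (FZ G) H"
    using FR_map_FZ_hom[OF fc] group.FZ_proj_hom[OF H] by (rule hom_compose)
  then interpret u: group_hom "FZ G" H "FZ_proj H \<circ> FR_map H f"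
    using H by (simp add: group_hom_def group_hom_axioms_def group_FZ)
  have "f \<circ> FZ_proj G \<in> hom (FZ G) H"
    using group.FZ_proj_hom[OF G] f by (rule hom_compose)
  then interpret v: group_hom "FZ G" H "f \<circ> FZ_proj G"
    using H by (simp add: group_hom_def group_hom_axioms_def group_FZ)
  have "(FZ_proj H \<circ> FR_map H f) x = (f \<circ> FZ_proj G) x"
    using x
  proof (induction rule: FZ_induct)
    case one
    show ?case by (simp only: u.hom_one v.hom_one)
  next
    case (letter g)
    then have "f g \<in> carrier H" using fc by auto
    then show ?case
      using letter by (simp add: FR_map_letter[OF fc] group.FZ_proj_letter[OF G] group.FZ_proj_letter[OF H])
  next
    case (inv g)
    then show ?case by (simp only: u.hom_inv v.hom_inv letter_1_in_FZ)
  next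
    case (mult y z)
    then show ?case by (simp only: u.hom_mult v.hom_mult)
  qed
  then show ?thesis by simp
qed

section \<open>The directional asymptotic cone\<close>

context conj_inv_normed_group
begin

lemma FR_pseudonorm: "conj_inv_pseudonormed_group (FR G) (FR_norm G nrm)"
  using nrm_nonneg by (rule FR_norm_pseudonorm)

text \<open>
  Scaling is a homomorphism, and products and inverses of Cauchy functions are Cauchy because the
  pseudometric is bi-invariant.
\<close>

lemma dir_words_subgroup: "subgroup (carrier (dir_words G nrm T)) (product_group T (\<lambda>_. FZ G))"
proof -
  interpret FR: conj_inv_pseudonormed_group "FR G" "FR_norm G nrm" by (rule FR_pseudonorm)
  interpret P: group "product_group T (\<lambda>_. FZ G)" by (simp add: group_FZ)
  interpret scale: group_hom "FR G" "FR G" "scale_hom G t" for t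
    using scale_hom_hom by (simp add: group_hom_def group_hom_axioms_def FR.is_group)
  let ?d = "group_dist (FR G) (FR_norm G nrm)"
  have FR: "w t \<in> carrier (FR G)" if "w \<in> carrier (dir_words G nrm T)" "t \<in> T" for w t
    using that FZ_subset_FR by (auto simp: dir_words_def)
  show ?thesis
  proof (rule P.subgroupI)
    show "carrier (dir_words G nrm T) \<subseteq> carrier (product_group T (\<lambda>_. FZ G))"
      by (auto simp: dir_words_def)
    have "pseudo_cauchy T ?d (\<lambda>t. scale_hom G (1 / t) (\<one>\<^bsub>product_group T (\<lambda>_. FZ G)\<^esub> t))"
      by (auto simp: pseudo_cauchy_def group_dist_def one_FZ FR.nrm_one)
    then have "\<one>\<^bsub>product_group T (\<lambda>_. FZ G)\<^esub> \<in> carrier (dir_words G nrm T)"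
      using P.one_closed by (simp add: dir_words_def del: one_product_group)
    then show "carrier (dir_words G nrm T) \<noteq> {}" by blast
  next
    fix u assume u: "u \<in> carrier (dir_words G nrm T)"
    have uZ: "u \<in> T \<rightarrow>\<^sub>E carrier (FZ G)" and uc: "pseudo_cauchy T ?d (\<lambda>t. scale_hom G (1 / t) (u t))"
      using u by (auto simp: dir_words_def)
    have inv: "inv\<^bsub>product_group T (\<lambda>_. FZ G)\<^esub> u = (\<lambda>t\<in>T. inv\<^bsub>FZ G\<^esub> u t)"
      using uZ by (simp add: group_FZ)
    have "pseudo_cauchy T ?d (\<lambda>t. inv\<^bsub>FR G\<^esub> scale_hom G (1 / t) (u t))"
      using FR[OF u] uc by (intro FR.pseudo_cauchy_inv) auto
    then have "pseudo_cauchy T ?d (\<lambda>t. scale_hom G (1 / t) ((\<lambda>t\<in>T. inv\<^bsub>FZ G\<^esub> u t) t))"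
      using FR[OF u] by (elim pseudo_cauchy_mono) (simp add: inv_FZ[OF PiE_mem[OF uZ]])
    moreover have "(\<lambda>t\<in>T. inv\<^bsub>FZ G\<^esub> u t) \<in> T \<rightarrow>\<^sub>E carrier (FZ G)"
      using P.inv_closed[of u] uZ unfolding inv by simp
    ultimately show "inv\<^bsub>product_group T (\<lambda>_. FZ G)\<^esub> u \<in> carrier (dir_words G nrm T)"
      unfolding inv by (simp add: dir_words_def)
    fix v assume v: "v \<in> carrier (dir_words G nrm T)"
    have vZ: "v \<in> T \<rightarrow>\<^sub>E carrier (FZ G)" and vc: "pseudo_cauchy T ?d (\<lambda>t. scale_hom G (1 / t) (v t))"
      using v by (auto simp: dir_words_def)
    have "pseudo_cauchy T ?d (\<lambda>t. scale_hom G (1 / t) (u t) \<otimes>\<^bsub>FR G\<^esub> scale_hom G (1 / t) (v t))"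
      using FR[OF u] FR[OF v] uc vc by (intro FR.pseudo_cauchy_mult) auto
    then have "pseudo_cauchy T ?d (\<lambda>t. scale_hom G (1 / t) ((\<lambda>t\<in>T. u t \<otimes>\<^bsub>FZ G\<^esub> v t) t))"
      using FR[OF u] FR[OF v] by (elim pseudo_cauchy_mono) (simp add: mult_FZ)
    moreover have "(\<lambda>t\<in>T. u t \<otimes>\<^bsub>FZ G\<^esub> v t) \<in> T \<rightarrow>\<^sub>E carrier (FZ G)"
      using P.m_closed[of u v] uZ vZ by simp
    ultimately show "u \<otimes>\<^bsub>product_group T (\<lambda>_. FZ G)\<^esub> v \<in> carrier (dir_words G nrm T)"
      by (simp add: dir_words_def)
  qed
qed

lemma dir_words_eq_restrict_carrier:
  "dir_words G nrm T = (product_group T (\<lambda>_. FZ G)) \<lparr>carrier := carrier (dir_words G nrm T)\<rparr>"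
  by (simp add: dir_words_def)

lemma group_dir_words: "group (dir_words G nrm T)"
proof -
  interpret P: group "product_group T (\<lambda>_. FZ G)" by (simp add: group_FZ)
  show ?thesis
    by (subst dir_words_eq_restrict_carrier) (rule P.subgroup_imp_group[OF dir_words_subgroup])
qed

lemma mult_dir_words: "u \<otimes>\<^bsub>dir_words G nrm T\<^esub> v = (\<lambda>t\<in>T. u t \<otimes>\<^bsub>FR G\<^esub> v t)"
  by (simp add: dir_words_def mult_FZ)

lemma dir_words_FZ: "w \<in> carrier (dir_words G nrm T) \<Longrightarrow> t \<in> T \<Longrightarrow> w t \<in> carrier (FZ G)"
  by (auto simp: dir_words_def)

lemma dir_words_cauchy:
  "w \<in> carrier (dir_words G nrm T) \<Longrightarrow>
     pseudo_cauchy T (group_dist (FR G) (FR_norm G nrm)) (\<lambda>t. scale_hom G (1 / t) (w t))"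
  by (simp add: dir_words_def)

lemma scale_hom_closed: "x \<in> carrier (FZ G) \<Longrightarrow> scale_hom G s x \<in> carrier (FR G)"
  using scale_hom_hom[of G s] FZ_subset_FR by (auto simp: hom_def)

lemma dir_words_norm_tendsto:
  assumes T: "scaling_set T" and w: "w \<in> carrier (dir_words G nrm T)"
  shows "((\<lambda>t. FR_norm G nrm (scale_hom G (1 / t) (w t))) \<longlongrightarrow> dir_words_norm G nrm T w) (at_top_within T)"
proof -
  interpret FR: conj_inv_pseudonormed_group "FR G" "FR_norm G nrm" by (rule FR_pseudonorm)
  show ?thesis
    unfolding dir_words_norm_def using w
    by (intro FR.nrm_tendsto_Lim T dir_words_cauchy) (auto intro: scale_hom_closed dir_words_FZ)
qed

lemma dir_words_pseudonorm:
  assumes T: "scaling_set T"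
  shows "conj_inv_pseudonormed_group (dir_words G nrm T) (dir_words_norm G nrm T)"
proof -
  interpret FR: conj_inv_pseudonormed_group "FR G" "FR_norm G nrm" by (rule FR_pseudonorm)
  have "(\<lambda>w. scale_hom G (1 / t) (w t)) \<in> hom (dir_words G nrm T) (FR G)" if t: "t \<in> T" for t
  proof (rule homI)
    fix u v assume uv: "u \<in> carrier (dir_words G nrm T)" "v \<in> carrier (dir_words G nrm T)"
    then have "u t \<in> carrier (FR G)" "v t \<in> carrier (FR G)"
      using dir_words_FZ t FZ_subset_FR by blast+
    then show "scale_hom G (1 / t) ((u \<otimes>\<^bsub>dir_words G nrm T\<^esub> v) t)
        = scale_hom G (1 / t) (u t) \<otimes>\<^bsub>FR G\<^esub> scale_hom G (1 / t) (v t)"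
      using scale_hom_hom[of G "1 / t"] t by (simp add: mult_dir_words hom_def)
  qed (use t in \<open>auto intro: scale_hom_closed dir_words_FZ\<close>)
  from FR.limit_pseudonorm[OF group_dir_words T this dir_words_cauchy]
  show ?thesis unfolding dir_words_norm_def by simp
qed

lemma carrier_dir_group:
  "carrier (dir_group G nrm T) = compose T (FZ_proj G) ` carrier (dir_words G nrm T)"
  by (simp add: dir_group_def)

lemma mult_dir_group: "x \<otimes>\<^bsub>dir_group G nrm T\<^esub> y = (\<lambda>t\<in>T. x t \<otimes> y t)"
  by (simp add: dir_group_def)

lemma carrier_dir_group_subset: "carrier (dir_group G nrm T) \<subseteq> T \<rightarrow>\<^sub>E carrier G"
  using FZ_proj_hom dir_words_FZ by (auto simp: carrier_dir_group compose_def hom_def Pi_iff)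

lemma dir_group_proj_hom:
  "compose T (FZ_proj G) \<in> hom (dir_words G nrm T) (product_group T (\<lambda>_. G))"
proof (rule homI)
  fix u v assume "u \<in> carrier (dir_words G nrm T)" "v \<in> carrier (dir_words G nrm T)"
  then have "FZ_proj G (u t \<otimes>\<^bsub>FR G\<^esub> v t) = FZ_proj G (u t) \<otimes> FZ_proj G (v t)" if "t \<in> T" for t
    using that dir_words_FZ FZ_proj_hom by (simp add: hom_def mult_FZ)
  then show "compose T (FZ_proj G) (u \<otimes>\<^bsub>dir_words G nrm T\<^esub> v)
      = compose T (FZ_proj G) u \<otimes>\<^bsub>product_group T (\<lambda>_. G)\<^esub> compose T (FZ_proj G) v"
    by (auto simp: compose_def mult_dir_words)
next
  fix u assume "u \<in> carrier (dir_words G nrm T)"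
  then show "compose T (FZ_proj G) u \<in> carrier (product_group T (\<lambda>_. G))"
    using carrier_dir_group_subset by (force simp: carrier_dir_group)
qed

lemma group_dir_group: "group (dir_group G nrm T)"
proof -
  interpret W: group "dir_words G nrm T" by (rule group_dir_words)
  interpret P: group "product_group T (\<lambda>_. G)" by (simp add: is_group)
  interpret p: group_hom "dir_words G nrm T" "product_group T (\<lambda>_. G)" "compose T (FZ_proj G)"
    using dir_group_proj_hom by (simp add: group_hom_def group_hom_axioms_def W.is_group P.is_group)
  show ?thesis
    unfolding dir_group_def by (rule P.subgroup_imp_group[OF p.img_is_subgroup])
qed

lemma dir_group_pseudonorm:
  assumes T: "scaling_set T"
  shows "conj_inv_pseudonormed_group (dir_group G nrm T) (dir_norm G nrm T)"
proof -
  interpret W: conj_inv_pseudonormed_group "dir_words G nrm T" "dir_words_norm G nrm T"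
    using T by (rule dir_words_pseudonorm)
  have "compose T (FZ_proj G) \<in> hom (dir_words G nrm T) (dir_group G nrm T)"
    using dir_group_proj_hom by (auto simp: hom_def dir_group_def)
  from W.pushforward_pseudonorm[OF group_dir_group this]
  show ?thesis unfolding dir_norm_def by (simp add: carrier_dir_group)
qed

lemma dir_norm_lower:
  assumes T: "scaling_set T" and w: "w \<in> carrier (dir_words G nrm T)"
  shows "dir_norm G nrm T (compose T (FZ_proj G) w) \<le> dir_words_norm G nrm T w"
proof -
  interpret W: conj_inv_pseudonormed_group "dir_words G nrm T" "dir_words_norm G nrm T"
    using T by (rule dir_words_pseudonorm)
  show ?thesis
    unfolding dir_norm_def using w W.nrm_nonneg
    by (intro cInf_lower bdd_belowI[of _ 0]) blast+
qed

lemma dir_norm_greatest: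
  assumes x: "x \<in> carrier (dir_group G nrm T)"
    and "\<And>w. w \<in> carrier (dir_words G nrm T) \<Longrightarrow> compose T (FZ_proj G) w = x \<Longrightarrow> a \<le> dir_words_norm G nrm T w"
  shows "a \<le> dir_norm G nrm T x"
proof -
  have "{dir_words_norm G nrm T w | w. w \<in> carrier (dir_words G nrm T) \<and> compose T (FZ_proj G) w = x} \<noteq> {}"
    using x unfolding carrier_dir_group by blast
  then show ?thesis
    unfolding dir_norm_def by (rule cInf_greatest) (use assms(2) in blast)
qed

end

text \<open>
  The induced map on free products commutes with the scalings and does not increase distances, so it
  preserves the Cauchy condition.
\<close>

lemma dir_words_map:
  fixes G :: "('a, 'm) monoid_scheme" and H :: "('b, 'k) monoid_scheme"
  assumes G: "conj_inv_normed_group G nG" and H: "conj_inv_normed_group H nH"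
    and f: "f \<in> hom G H" and le: "\<And>g. g \<in> carrier G \<Longrightarrow> nH (f g) \<le> nG g"
    and w: "w \<in> carrier (dir_words G nG T)"
  shows "compose T (FR_map H f) w \<in> carrier (dir_words H nH T)"
    and "t \<in> T \<Longrightarrow> scale_hom H s (compose T (FR_map H f) w t) = FR_map H f (scale_hom G s (w t))"
    and "compose T (FZ_proj H) (compose T (FR_map H f) w) = compose T f (compose T (FZ_proj G) w)"
proof -
  interpret G: conj_inv_normed_group G nG by (rule G)
  interpret H: conj_inv_normed_group H nH by (rule H)
  have fc: "f \<in> carrier G \<rightarrow> carrier H" using f by (simp add: hom_def)
  interpret FG: group "FR G" by (rule group_real_free_product)
  interpret f: group_hom "FR G" "FR H" "FR_map H f"
    using FR_map_hom[OF fc] by (simp add: group_hom_def group_hom_axioms_def group_real_free_product)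
  note FZ = G.dir_words_FZ[OF w]
  show scale: "scale_hom H s (compose T (FR_map H f) w t) = FR_map H f (scale_hom G s (w t))"
    if "t \<in> T" for t s
    using that FZ[OF that] by (simp add: compose_def FR_map_scale_hom[OF fc] FZ_in_FR)
  have "group_dist (FR H) (FR_norm H nH) (FR_map H f x) (FR_map H f y)
      \<le> group_dist (FR G) (FR_norm G nG) x y"
    if "x \<in> carrier (FR G)" "y \<in> carrier (FR G)" for x y
    using FR_norm_FR_map_le[where nH = nH and nG = nG, OF fc H.nrm_nonneg le, of "inv\<^bsub>FR G\<^esub> x \<otimes>\<^bsub>FR G\<^esub> y"] that
    by (simp add: group_dist_def)
  then have "pseudo_cauchy T (group_dist (FR H) (FR_norm H nH))
      (\<lambda>t. scale_hom H (1 / t) (compose T (FR_map H f) w t))"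
    using G.dir_words_cauchy[OF w]
    by (elim pseudo_cauchy_mono) (simp add: scale G.scale_hom_closed FZ)
  moreover have "compose T (FR_map H f) w \<in> T \<rightarrow>\<^sub>E carrier (FZ H)"
    using FZ FR_map_FZ_hom[OF fc] by (auto simp: compose_def hom_def Pi_iff)
  ultimately show "compose T (FR_map H f) w \<in> carrier (dir_words H nH T)"
    by (simp add: dir_words_def)
  show "compose T (FZ_proj H) (compose T (FR_map H f) w) = compose T f (compose T (FZ_proj G) w)"
    using FZ FZ_proj_FR_map[OF G.is_group H.is_group f] by (auto simp: compose_def)
qed

text \<open>
  A lift of \<open>x\<close> is mapped to a lift of the image of \<open>x\<close>, of no larger pseudonorm.
\<close>

lemma dir_group_map:
  fixes G :: "('a, 'm) monoid_scheme" and H :: "('b, 'k) monoid_scheme"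
  assumes G: "conj_inv_normed_group G nG" and H: "conj_inv_normed_group H nH"
    and f: "f \<in> hom G H" and le: "\<And>g. g \<in> carrier G \<Longrightarrow> nH (f g) \<le> nG g"
    and T: "scaling_set T" and x: "x \<in> carrier (dir_group G nG T)"
  shows "compose T f x \<in> carrier (dir_group H nH T)"
    and "dir_norm H nH T (compose T f x) \<le> dir_norm G nG T x"
proof -
  interpret G: conj_inv_normed_group G nG by (rule G)
  interpret H: conj_inv_normed_group H nH by (rule H)
  have fc: "f \<in> carrier G \<rightarrow> carrier H" using f by (simp add: hom_def)
  note map = dir_words_map[OF G H f le]
  show "compose T f x \<in> carrier (dir_group H nH T)"
  proof -
    obtain w where w: "w \<in> carrier (dir_words G nG T)" "x = compose T (FZ_proj G) w"
      using x unfolding G.carrier_dir_group by blast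
    show ?thesis
      unfolding w(2) H.carrier_dir_group using map(1,3)[OF _ w(1)] by (metis imageI)
  qed
  show "dir_norm H nH T (compose T f x) \<le> dir_norm G nG T x"
  proof (rule G.dir_norm_greatest[OF x])
    fix w assume w: "w \<in> carrier (dir_words G nG T)" "compose T (FZ_proj G) w = x"
    note m = map(1,3)[OF _ w(1)]
    have "dir_norm H nH T (compose T f x) \<le> dir_words_norm H nH T (compose T (FR_map H f) w)"
      using H.dir_norm_lower[OF T m(1)] m(2) w(2) by simp
    also have "\<dots> \<le> dir_words_norm G nG T w"
    proof (rule tendsto_le[OF at_top_within_neq_bot[OF T] G.dir_words_norm_tendsto[OF T w(1)]
            H.dir_words_norm_tendsto[OF T m(1)] eventually_at_top_withinI])
      fix t assume t: "t \<in> T"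
      show "FR_norm H nH (scale_hom H (1 / t) (compose T (FR_map H f) w t))
          \<le> FR_norm G nG (scale_hom G (1 / t) (w t))"
        using FR_norm_FR_map_le[where nH = nH and nG = nG, OF fc H.nrm_nonneg le]
          G.scale_hom_closed[OF G.dir_words_FZ[OF w(1) t]]
        by (simp add: map(2)[OF _ w(1) t])
    qed
    finally show "dir_norm H nH T (compose T f x) \<le> dir_words_norm G nG T w" .
  qed
qed

section \<open>The cone of a product\<close>

lemma l1_conj_inv_normed_group:
  assumes "conj_inv_normed_group G nG" "conj_inv_normed_group H nH"
  shows "conj_inv_normed_group (G \<times>\<times> H) (l1_norm nG nH)"
proof -
  interpret G: conj_inv_normed_group G nG by fact
  interpret H: conj_inv_normed_group H nH by fact
  interpret P: group "G \<times>\<times> H" by (intro DirProd_group G.is_group H.is_group)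
  show ?thesis
  proof
    fix x assume "x \<in> carrier (G \<times>\<times> H)"
    then obtain a b where x: "x = (a, b)" "a \<in> carrier G" "b \<in> carrier H" by auto
    show "0 \<le> l1_norm nG nH x"
      using x by (simp add: l1_norm_def G.nrm_nonneg H.nrm_nonneg)
    show "l1_norm nG nH x = 0 \<longleftrightarrow> x = \<one>\<^bsub>G \<times>\<times> H\<^esub>"
      using x G.nrm_nonneg[of a] H.nrm_nonneg[of b] G.nrm_eq_0_iff[of a] H.nrm_eq_0_iff[of b]
      by (simp add: l1_norm_def add_nonneg_eq_0_iff)
    show "l1_norm nG nH (inv\<^bsub>G \<times>\<times> H\<^esub> x) = l1_norm nG nH x"
      using x by (simp add: l1_norm_def G.is_group H.is_group G.nrm_inv H.nrm_inv)
    fix y assume "y \<in> carrier (G \<times>\<times> H)"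
    then obtain c d where y: "y = (c, d)" "c \<in> carrier G" "d \<in> carrier H" by auto
    show "l1_norm nG nH (x \<otimes>\<^bsub>G \<times>\<times> H\<^esub> y) \<le> l1_norm nG nH x + l1_norm nG nH y"
      using x y G.nrm_mult[of a c] H.nrm_mult[of b d] by (simp add: l1_norm_def)
    show "l1_norm nG nH (y \<otimes>\<^bsub>G \<times>\<times> H\<^esub> x \<otimes>\<^bsub>G \<times>\<times> H\<^esub> inv\<^bsub>G \<times>\<times> H\<^esub> y) = l1_norm nG nH x"
      using x y by (simp add: l1_norm_def G.is_group H.is_group G.nrm_conj H.nrm_conj)
  qed
qed

context
  fixes G :: "('a, 'm) monoid_scheme" and n :: "'a \<Rightarrow> real" and T :: "real set"
  assumes G: "conj_inv_normed_group G n" and T: "scaling_set T"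
begin

interpretation conj_inv_normed_group G n by (rule G)
interpretation C: conj_inv_pseudonormed_group "dir_group G n T" "dir_norm G n T"
  using T by (rule dir_group_pseudonorm)

lemma null_functions_eq_null_set: "null_functions G n T = C.null_set"
  by (simp add: null_functions_def C.null_set_def)

lemma dir_class_hom: "dir_class G n T \<in> hom (dir_group G n T) (dir_cone G n T)"
  unfolding dir_class_def dir_cone_def null_functions_eq_null_set
  using normal.r_coset_hom_Mod[OF C.normal_null_set] .

lemma carrier_dir_cone: "carrier (dir_cone G n T) = dir_class G n T ` carrier (dir_group G n T)"
  by (simp add: dir_cone_def dir_class_def carrier_FactGroup)

lemma group_dir_cone: "group (dir_cone G n T)"
  unfolding dir_cone_def null_functions_eq_null_set
  using C.normal_null_set by (rule normal.factorgroup_is_group)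

lemma dir_cone_norm_dir_class:
  "g \<in> carrier (dir_group G n T) \<Longrightarrow> dir_cone_norm G n T (dir_class G n T g) = dir_norm G n T g"
  unfolding dir_cone_norm_def dir_class_def null_functions_eq_null_set by (rule C.quotient_nrm)

lemma dir_cone_norm_nonneg: "X \<in> carrier (dir_cone G n T) \<Longrightarrow> 0 \<le> dir_cone_norm G n T X"
  using C.nrm_nonneg by (auto simp: carrier_dir_cone dir_cone_norm_dir_class)

lemma dir_cone_norm_eq_0_iff:
  assumes "X \<in> carrier (dir_cone G n T)"
  shows "dir_cone_norm G n T X = 0 \<longleftrightarrow> X = \<one>\<^bsub>dir_cone G n T\<^esub>"
proof -
  obtain g where g: "g \<in> carrier (dir_group G n T)" "X = dir_class G n T g"
    using assms by (auto simp: carrier_dir_cone)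
  show ?thesis
    unfolding g(2) dir_cone_norm_dir_class[OF g(1)] C.rcos_null_set_eq_iff_nrm_0[OF g(1), symmetric]
    by (simp add: dir_cone_def dir_class_def null_functions_eq_null_set)
qed

end

lemma compose_pair_fun:
  assumes "g \<in> T \<rightarrow>\<^sub>E A" "h \<in> T \<rightarrow>\<^sub>E B"
  shows "compose T fst (pair_fun T g h) = g" "compose T snd (pair_fun T g h) = h"
  using assms by (auto simp: compose_def pair_fun_def PiE_def extensional_def)

lemma fst_hom: "fst \<in> hom (G \<times>\<times> H) G" and snd_hom: "snd \<in> hom (G \<times>\<times> H) H"
  by (auto simp: hom_def)

context
  fixes G :: "('a, 'm) monoid_scheme" and H :: "('b, 'k) monoid_scheme"
    and nG :: "'a \<Rightarrow> real" and nH :: "'b \<Rightarrow> real" and T :: "real set"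
  assumes G: "conj_inv_normed_group G nG" and H: "conj_inv_normed_group H nH"
    and T: "scaling_set T"
begin

interpretation G: conj_inv_normed_group G nG by (rule G)
interpretation H: conj_inv_normed_group H nH by (rule H)

interpretation P: conj_inv_normed_group "G \<times>\<times> H" "l1_norm nG nH"
  using G H by (rule l1_conj_inv_normed_group)
interpretation CP: conj_inv_pseudonormed_group "dir_group (G \<times>\<times> H) (l1_norm nG nH) T" "dir_norm (G \<times>\<times> H) (l1_norm nG nH) T"
  using T by (rule P.dir_group_pseudonorm)

lemma nrm_fst_le: "x \<in> carrier (G \<times>\<times> H) \<Longrightarrow> nG (fst x) \<le> l1_norm nG nH x"
  and nrm_snd_le: "x \<in> carrier (G \<times>\<times> H) \<Longrightarrow> nH (snd x) \<le> l1_norm nG nH x"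
  by (auto simp: l1_norm_def G.nrm_nonneg H.nrm_nonneg)

lemma pair_fun_compose:
  assumes "x \<in> carrier (dir_group (G \<times>\<times> H) (l1_norm nG nH) T)"
  shows "pair_fun T (compose T fst x) (compose T snd x) = x"
  using subsetD[OF P.carrier_dir_group_subset assms]
  by (auto simp: compose_def pair_fun_def PiE_def extensional_def)

lemma dir_group_fst:
  "x \<in> carrier (dir_group (G \<times>\<times> H) (l1_norm nG nH) T) \<Longrightarrow> compose T fst x \<in> carrier (dir_group G nG T)"
  by (rule dir_group_map(1)[OF P.conj_inv_normed_group_axioms G fst_hom nrm_fst_le T])

lemma dir_group_snd:
  "x \<in> carrier (dir_group (G \<times>\<times> H) (l1_norm nG nH) T) \<Longrightarrow> compose T snd x \<in> carrier (dir_group H nH T)"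
  by (rule dir_group_map(1)[OF P.conj_inv_normed_group_axioms H snd_hom nrm_snd_le T])

text \<open>
  The function is the pointwise product of the images of \<open>g\<close> and \<open>h\<close> under the two inclusions of the
  factors, which preserve norms; closure under products and the triangle inequality do the rest.
\<close>

lemma pair_fun_closed_and_norm_le:
  assumes g: "g \<in> carrier (dir_group G nG T)" and h: "h \<in> carrier (dir_group H nH T)"
  shows "pair_fun T g h \<in> carrier (dir_group (G \<times>\<times> H) (l1_norm nG nH) T)"
    and "dir_norm (G \<times>\<times> H) (l1_norm nG nH) T (pair_fun T g h) \<le> dir_norm G nG T g + dir_norm H nH T h"
proof -
  let ?i = "\<lambda>a. (a, \<one>\<^bsub>H\<^esub>)" and ?j = "\<lambda>b. (\<one>\<^bsub>G\<^esub>, b)"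
  have i: "?i \<in> hom G (G \<times>\<times> H)" and j: "?j \<in> hom H (G \<times>\<times> H)"
    by (auto simp: hom_def)
  have le: "l1_norm nG nH (?i a) \<le> nG a" "l1_norm nG nH (?j b) \<le> nH b" for a b
    using G.nrm_eq_0_iff[of "\<one>\<^bsub>G\<^esub>"] H.nrm_eq_0_iff[of "\<one>\<^bsub>H\<^esub>"] by (simp_all add: l1_norm_def)
  note ig = dir_group_map[OF G P.conj_inv_normed_group_axioms i le(1) T g] and jh = dir_group_map[OF H P.conj_inv_normed_group_axioms j le(2) T h]
  have gh: "g \<in> T \<rightarrow>\<^sub>E carrier G" "h \<in> T \<rightarrow>\<^sub>E carrier H"
    using G.carrier_dir_group_subset H.carrier_dir_group_subset g h by blast+
  have eq: "compose T ?i g \<otimes>\<^bsub>dir_group (G \<times>\<times> H) (l1_norm nG nH) T\<^esub> compose T ?j h = pair_fun T g h"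
    unfolding P.mult_dir_group pair_fun_def using gh
    by (intro restrict_ext) (simp add: compose_def PiE_mem[OF gh(1)] PiE_mem[OF gh(2)])
  show "pair_fun T g h \<in> carrier (dir_group (G \<times>\<times> H) (l1_norm nG nH) T)"
    using CP.m_closed[OF ig(1) jh(1)] unfolding eq .
  show "dir_norm (G \<times>\<times> H) (l1_norm nG nH) T (pair_fun T g h) \<le> dir_norm G nG T g + dir_norm H nH T h"
    using CP.nrm_mult[OF ig(1) jh(1)] ig(2) jh(2) unfolding eq by linarith
qed

text \<open>
  A lift of \<open>x\<close> projects to a lift of each component. The norms of the two
  projected words add up to at most the norm of the word at each \<open>t\<close>, hence also in the limit.
\<close>

lemma dir_norm_fst_add_snd_le:
  assumes x: "x \<in> carrier (dir_group (G \<times>\<times> H) (l1_norm nG nH) T)"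
  shows "dir_norm G nG T (compose T fst x) + dir_norm H nH T (compose T snd x) \<le> dir_norm (G \<times>\<times> H) (l1_norm nG nH) T x"
proof (rule P.dir_norm_greatest[OF x])
  fix w assume w: "w \<in> carrier (dir_words (G \<times>\<times> H) (l1_norm nG nH) T)" "compose T (FZ_proj (G \<times>\<times> H)) w = x"
  let ?u = "compose T (FR_map G fst) w" and ?v = "compose T (FR_map H snd) w"
  have u: "?u \<in> carrier (dir_words G nG T)" "compose T (FZ_proj G) ?u = compose T fst x"
    and v: "?v \<in> carrier (dir_words H nH T)" "compose T (FZ_proj H) ?v = compose T snd x"
    using dir_words_map(1,3)[OF P.conj_inv_normed_group_axioms G fst_hom nrm_fst_le w(1)] dir_words_map(1,3)[OF P.conj_inv_normed_group_axioms H snd_hom nrm_snd_le w(1)] w(2)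
    by simp_all
  have "dir_norm G nG T (compose T fst x) + dir_norm H nH T (compose T snd x)
      \<le> dir_words_norm G nG T ?u + dir_words_norm H nH T ?v"
    using G.dir_norm_lower[OF T u(1)] H.dir_norm_lower[OF T v(1)] u(2) v(2) by simp
  also have "\<dots> \<le> dir_words_norm (G \<times>\<times> H) (l1_norm nG nH) T w"
  proof (rule tendsto_le[OF at_top_within_neq_bot[OF T] P.dir_words_norm_tendsto[OF T w(1)]
          tendsto_add[OF G.dir_words_norm_tendsto[OF T u(1)] H.dir_words_norm_tendsto[OF T v(1)]]
          eventually_at_top_withinI])
    fix t assume t: "t \<in> T"
    have scale: "scale_hom G s (?u t) = FR_map G fst (scale_hom (G \<times>\<times> H) s (w t))"
      "scale_hom H s (?v t) = FR_map H snd (scale_hom (G \<times>\<times> H) s (w t))" for s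
      by (rule dir_words_map(2)[OF P.conj_inv_normed_group_axioms G fst_hom nrm_fst_le w(1) t]
          dir_words_map(2)[OF P.conj_inv_normed_group_axioms H snd_hom nrm_snd_le w(1) t]; assumption)+
    have "FR_norm G nG (FR_map G fst y) + FR_norm H nH (FR_map H snd y) \<le> FR_norm (G \<times>\<times> H) (l1_norm nG nH) y"
      if "y \<in> carrier (FR (G \<times>\<times> H))" for y
      using that
      by (rule FR_norm_FR_map_add_le[where nH = nG and nK = nH and nG = "l1_norm nG nH", rotated -1])
        (auto simp: l1_norm_def G.nrm_nonneg H.nrm_nonneg)
    then show "FR_norm G nG (scale_hom G (1 / t) (?u t)) + FR_norm H nH (scale_hom H (1 / t) (?v t))
        \<le> FR_norm (G \<times>\<times> H) (l1_norm nG nH) (scale_hom (G \<times>\<times> H) (1 / t) (w t))"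
      unfolding scale using P.scale_hom_closed[OF P.dir_words_FZ[OF w(1) t]] by blast
  qed
  finally show "dir_norm G nG T (compose T fst x) + dir_norm H nH T (compose T snd x)
      \<le> dir_words_norm (G \<times>\<times> H) (l1_norm nG nH) T w" .
qed

lemma dir_norm_fst_add_snd:
  assumes x: "x \<in> carrier (dir_group (G \<times>\<times> H) (l1_norm nG nH) T)"
  shows "dir_norm G nG T (compose T fst x) + dir_norm H nH T (compose T snd x) = dir_norm (G \<times>\<times> H) (l1_norm nG nH) T x"
  using dir_norm_fst_add_snd_le[OF x] pair_fun_compose[OF x]
    pair_fun_closed_and_norm_le(2)[OF dir_group_fst[OF x] dir_group_snd[OF x]] by simp

definition product_class :: "(real \<Rightarrow> 'a \<times> 'b) \<Rightarrow> (real \<Rightarrow> 'a) set \<times> (real \<Rightarrow> 'b) set" where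
  "product_class x = (dir_class G nG T (compose T fst x), dir_class H nH T (compose T snd x))"

lemma product_class_hom:
  "product_class \<in> hom (dir_group (G \<times>\<times> H) (l1_norm nG nH) T) (dir_cone G nG T \<times>\<times> dir_cone H nH T)"
proof (rule homI)
  fix x y assume x: "x \<in> carrier (dir_group (G \<times>\<times> H) (l1_norm nG nH) T)" and y: "y \<in> carrier (dir_group (G \<times>\<times> H) (l1_norm nG nH) T)"
  have xy: "compose T fst (x \<otimes>\<^bsub>dir_group (G \<times>\<times> H) (l1_norm nG nH) T\<^esub> y)
        = compose T fst x \<otimes>\<^bsub>dir_group G nG T\<^esub> compose T fst y"
    "compose T snd (x \<otimes>\<^bsub>dir_group (G \<times>\<times> H) (l1_norm nG nH) T\<^esub> y)
        = compose T snd x \<otimes>\<^bsub>dir_group H nH T\<^esub> compose T snd y"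
    unfolding P.mult_dir_group G.mult_dir_group H.mult_dir_group
    by (auto simp: compose_def mult_DirProd')
  show "product_class (x \<otimes>\<^bsub>dir_group (G \<times>\<times> H) (l1_norm nG nH) T\<^esub> y)
      = product_class x \<otimes>\<^bsub>dir_cone G nG T \<times>\<times> dir_cone H nH T\<^esub> product_class y"
    unfolding product_class_def xy
    using dir_class_hom[OF G T] dir_class_hom[OF H T] dir_group_fst dir_group_snd x y by (simp add: hom_def)
next
  fix x assume "x \<in> carrier (dir_group (G \<times>\<times> H) (l1_norm nG nH) T)"
  then show "product_class x \<in> carrier (dir_cone G nG T \<times>\<times> dir_cone H nH T)"
    using dir_group_fst dir_group_snd
    by (simp add: product_class_def carrier_dir_cone[OF G T] carrier_dir_cone[OF H T])
qed

lemma product_class_pair_fun: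
  assumes "g \<in> carrier (dir_group G nG T)" "h \<in> carrier (dir_group H nH T)"
  shows "product_class (pair_fun T g h) = (dir_class G nG T g, dir_class H nH T h)"
  using compose_pair_fun[OF subsetD[OF G.carrier_dir_group_subset assms(1)] subsetD[OF H.carrier_dir_group_subset assms(2)]]
  by (simp add: product_class_def)

lemma product_class_surj:
  "product_class ` carrier (dir_group (G \<times>\<times> H) (l1_norm nG nH) T) = carrier (dir_cone G nG T \<times>\<times> dir_cone H nH T)"
proof
  show "product_class ` carrier (dir_group (G \<times>\<times> H) (l1_norm nG nH) T) \<subseteq> carrier (dir_cone G nG T \<times>\<times> dir_cone H nH T)"
    by (rule hom_carrier[OF product_class_hom])
  show "carrier (dir_cone G nG T \<times>\<times> dir_cone H nH T) \<subseteq> product_class ` carrier (dir_group (G \<times>\<times> H) (l1_norm nG nH) T)"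
    using product_class_pair_fun pair_fun_closed_and_norm_le(1)
    by (force simp: carrier_dir_cone[OF G T] carrier_dir_cone[OF H T])
qed

lemma dir_cone_product_isometry:
  "(\<lambda>X. the_elem (product_class ` X)) \<in> isometric_iso
      (dir_cone (G \<times>\<times> H) (l1_norm nG nH) T) (dir_cone_norm (G \<times>\<times> H) (l1_norm nG nH) T)
      (dir_cone G nG T \<times>\<times> dir_cone H nH T) (l1_norm (dir_cone_norm G nG T) (dir_cone_norm H nH T))"
  "x \<in> carrier (dir_group (G \<times>\<times> H) (l1_norm nG nH) T) \<Longrightarrow>
      the_elem (product_class ` dir_class (G \<times>\<times> H) (l1_norm nG nH) T x) = product_class x"
proof -
  have norm: "l1_norm (dir_cone_norm G nG T) (dir_cone_norm H nH T) (product_class x)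
      = dir_norm (G \<times>\<times> H) (l1_norm nG nH) T x" if "x \<in> carrier (dir_group (G \<times>\<times> H) (l1_norm nG nH) T)" for x
    using dir_norm_fst_add_snd[OF that] dir_group_fst[OF that] dir_group_snd[OF that]
    by (simp add: l1_norm_def product_class_def dir_cone_norm_dir_class[OF G T] dir_cone_norm_dir_class[OF H T])
  have zero: "l1_norm (dir_cone_norm G nG T) (dir_cone_norm H nH T) Y = 0
      \<longleftrightarrow> Y = \<one>\<^bsub>dir_cone G nG T \<times>\<times> dir_cone H nH T\<^esub>"
    if "Y \<in> carrier (dir_cone G nG T \<times>\<times> dir_cone H nH T)" for Y
    using that dir_cone_norm_nonneg[OF G T] dir_cone_norm_nonneg[OF H T]
      dir_cone_norm_eq_0_iff[OF G T] dir_cone_norm_eq_0_iff[OF H T]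
    by (auto simp: l1_norm_def add_nonneg_eq_0_iff)
  note quotient = CP.isometric_iso_quotient[
      where m = "l1_norm (dir_cone_norm G nG T) (dir_cone_norm H nH T)", OF DirProd_group[OF group_dir_cone[OF G T] group_dir_cone[OF H T]]
      product_class_hom product_class_surj norm zero]
  show "(\<lambda>X. the_elem (product_class ` X)) \<in> isometric_iso
      (dir_cone (G \<times>\<times> H) (l1_norm nG nH) T) (dir_cone_norm (G \<times>\<times> H) (l1_norm nG nH) T)
      (dir_cone G nG T \<times>\<times> dir_cone H nH T) (l1_norm (dir_cone_norm G nG T) (dir_cone_norm H nH T))"
    unfolding dir_cone_def[of "G \<times>\<times> H"] dir_cone_norm_def[of "G \<times>\<times> H", abs_def] null_functions_eq_null_set[OF P.conj_inv_normed_group_axioms T]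
    by (rule quotient(1))
  show "x \<in> carrier (dir_group (G \<times>\<times> H) (l1_norm nG nH) T) \<Longrightarrow>
      the_elem (product_class ` dir_class (G \<times>\<times> H) (l1_norm nG nH) T x) = product_class x"
    unfolding dir_class_def[of "G \<times>\<times> H"] null_functions_eq_null_set[OF P.conj_inv_normed_group_axioms T]
    by (rule quotient(2))
qed

end

theorem theorem7p3:
  fixes G :: "('a, 'm) monoid_scheme" and H :: "('b, 'k) monoid_scheme"
    and nG :: "'a \<Rightarrow> real" and nH :: "'b \<Rightarrow> real"
    and T :: "real set"
  assumes "conj_inv_normed_group G nG"
    and "conj_inv_normed_group H nH"
    and "scaling_set T"
  shows "\<exists>\<Phi> \<in> isometric_iso
             (dir_cone (G \<times>\<times> H) (l1_norm nG nH) T)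
             (dir_cone_norm (G \<times>\<times> H) (l1_norm nG nH) T)
             (dir_cone G nG T \<times>\<times> dir_cone H nH T)
             (l1_norm (dir_cone_norm G nG T) (dir_cone_norm H nH T)).
           \<forall>g \<in> T \<rightarrow>\<^sub>E carrier G. \<forall>h \<in> T \<rightarrow>\<^sub>E carrier H.
             (pair_fun T g h \<in> carrier (dir_group (G \<times>\<times> H) (l1_norm nG nH) T) \<longleftrightarrow>
                g \<in> carrier (dir_group G nG T) \<and> h \<in> carrier (dir_group H nH T)) \<and>
             (pair_fun T g h \<in> carrier (dir_group (G \<times>\<times> H) (l1_norm nG nH) T) \<longrightarrow>
                \<Phi> (dir_class (G \<times>\<times> H) (l1_norm nG nH) T (pair_fun T g h)) =
                  (dir_class G nG T g, dir_class H nH T h))"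
proof (intro bexI ballI conjI)
  show "(\<lambda>X. the_elem (product_class G H nG nH T ` X)) \<in> isometric_iso
      (dir_cone (G \<times>\<times> H) (l1_norm nG nH) T) (dir_cone_norm (G \<times>\<times> H) (l1_norm nG nH) T)
      (dir_cone G nG T \<times>\<times> dir_cone H nH T) (l1_norm (dir_cone_norm G nG T) (dir_cone_norm H nH T))"
    by (rule dir_cone_product_isometry(1)[OF assms])
  fix g h assume g: "g \<in> T \<rightarrow>\<^sub>E carrier G" and h: "h \<in> T \<rightarrow>\<^sub>E carrier H"
  show iff: "pair_fun T g h \<in> carrier (dir_group (G \<times>\<times> H) (l1_norm nG nH) T) \<longleftrightarrow>
      g \<in> carrier (dir_group G nG T) \<and> h \<in> carrier (dir_group H nH T)"
    using dir_group_fst[OF assms, of "pair_fun T g h"] dir_group_snd[OF assms, of "pair_fun T g h"]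
      pair_fun_closed_and_norm_le(1)[OF assms, of g h] compose_pair_fun[OF g h] by auto
  show "pair_fun T g h \<in> carrier (dir_group (G \<times>\<times> H) (l1_norm nG nH) T) \<longrightarrow>
      the_elem (product_class G H nG nH T ` dir_class (G \<times>\<times> H) (l1_norm nG nH) T (pair_fun T g h)) =
      (dir_class G nG T g, dir_class H nH T h)"
    using dir_cone_product_isometry(2)[OF assms, of "pair_fun T g h"]
      product_class_pair_fun[OF assms, of g h] iff by auto
qed

end
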